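(* Let $n\ge1$, $\beta>0$, $\gamma>0$, and let $\Omega$ be the open unit ball $B(0,1)\subset\mathbf{R}^n$. For $r\ge1$ let $$\Gamma(r)=\begin{cases} r-1 & \text{if } n=1,\\ \ln(r) & \text{if } n=2,\\ \frac{1}{n-2}\left(1-r^{2-n}\right) & \text{if } n\ge3,\end{cases}\qquad \delta(r)=\frac{1}{1+\beta r^{n-1}\Gamma(r)}.$$ Assume that $\beta\ge n-\tfrac12$ and that there exists $R\ge1$ such that $$\left(\beta^2-\frac{\beta(n-1)}{R}\right)\delta(R)^2=\gamma^2.$$ Then the function $u\colon\mathbf{R}^n\to\mathbf{R}$ defined by $$u(x)=\begin{cases}1&\text{for }|x|\le1,\\ 1-\beta\,\delta(R)\,R^{n-1}\,\Gamma(|x|)&\text{for }1\le|x|\le R,\\ 0&\text{for }|x|>R\end{cases}$$ has a calibration.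
   Context: Fix parameters $\beta,\gamma>0$. The problem under consideration is the minimization of $E(u)=\int|\nabla u|^2\,\mathrm{d}x+\beta\int_{J_u}\big((u^+)^2+(u^-)^2\big)\,\mathrm{d}\mathcal{H}^{n-1}+\gamma^2\mathcal{L}^n(\{u>0\})$ among $u\in SBV(\mathbf{R}^n)$ with $u=1$ on $\Omega$ and $0\le u\le1$. Jump set: for $u\in SBV(\mathbf{R}^n)$, $J_u$ is the set of jump points of $u$, i.e. points $x$ for which there are real numbers $u^-(x)<u^+(x)$ and a unit vector $\nu_u(x)$ such that $u$ has approximate limit (in the $L^1$-average sense on half-balls centred at $x$, as the radius tends to $0$) $u^+(x)$ on the side $\{(y-x)\cdot\nu_u(x)>0\}$ and $u^-(x)$ on the side $\{(y-x)\cdot\nu_u(x)<0\}$; thus $\nu_u$ points toward the higher trace. Approximately regular: for $D\subset\mathbf{R}^n\times\mathbf{R}$, a bounded Borel vector field $\phi\colon D\to\mathbf{R}^n\times\mathbf{R}$ is approximately regular on $D$ if for every Lipschitz hypersurface $S\subset\mathbf{R}^n\times\mathbf{R}$ with unit normal $\nu_S$, for $\mathcal{H}^n$-a.e. $z_0\in S\cap D$, the function $z\mapsto\phi(z)\cdot\nu_S(z_0)$, $z\in D$, has approximate limit $\phi(z_0)\cdot\nu_S(z_0)$ at $z_0$ (i.e. for every $\varepsilon>0$ the set $\{z\in D:|(\phi(z)-\phi(z_0))\cdot\nu_S(z_0)|>\varepsilon\}$ has Lebesgue density $0$ at $z_0$). Calibration: let $\Omega$ be a bounded open set of $\mathbf{R}^n$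 with Lipschitz boundary and let $u\in SBV(\mathbf{R}^n)$ have compact support, with $u=1$ on $\Omega$ and $0\le u\le1$ in $\mathbf{R}^n$. A calibration for $u$ is a Borel map $\phi=(\phi^x,\phi^t)\colon(\mathbf{R}^n\setminus\Omega)\times[0,1]\to\mathbf{R}^n\times\mathbf{R}$ which is bounded and approximately regular on $(\mathbf{R}^n\setminus\Omega)\times[0,1]$, divergence-free on $(\mathbf{R}^n\setminus\overline{\Omega})\times\,]0,1[$ in the sense of distributions, and such that (a) $\phi^t(x,t)\ge\frac14|\phi^x(x,t)|^2-\gamma^2\mathbf{1}_{\{t>0\}}(t)$ for $\mathcal{L}^n$-a.e. $x\in\mathbf{R}^n\setminus\overline{\Omega}$ and every $t\in[0,1]$; (b) $\left|\int_r^s\phi^x(x,t)\,\mathrm{d}t\right|\le\beta(r^2+s^2)$ for $\mathcal{H}^{n-1}$-a.e. $x\in\mathbf{R}^n\setminus\Omega$ and every $r,s\in[0,1]$; (a') $\phi^x(x,u(x))=2\nabla u(x)$ and $\phi^t(x,u(x))=|\nabla u(x)|^2-\gamma^2\mathbf{1}_{\{t>0\}}(u(x))$ for $\mathcal{L}^n$-a.e. $x\in\mathbf{R}^n\setminus\overline{\Omega}$; (b') $\int_{u^-}^{u^+}\phi^x(x,t)\,\mathrm{d}t=\beta\left[(u^-)^2+(u^+)^2\right]\nu_u$ for $\mathcal{H}^{n-1}$-a.e. $x\in J_u$. *)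

theory Defs
  imports "HOL-Analysis.Analysis"
begin

text \<open>The \<open>k\<close>-dimensional Hausdorff (outer) measure with the usual normalization
  \<open>\<omega>\<^sub>k (diam C / 2)^k\<close>. The empty set has weight 0 also for \<open>k = 0\<close>, so that the
  0-dimensional measure is the counting measure. Boundedness is required because \<^const>\<open>diameter\<close>
  is meaningless on unbounded sets.\<close>

definition hausdorff_weight :: "nat \<Rightarrow> 'a::metric_space set \<Rightarrow> ennreal" where
  "hausdorff_weight k C =
     (if C = {} then 0 else ennreal (unit_ball_vol (real k) * (diameter C / 2) ^ k))"

definition hausdorff_measure :: "nat \<Rightarrow> 'a::metric_space set \<Rightarrow> ennreal" where
  "hausdorff_measure k A =
     (SUP d\<in>{0<..}. INF C\<in>{C :: nat \<Rightarrow> 'a set.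
          A \<subseteq> (\<Union>i. C i) \<and> (\<forall>i. bounded (C i) \<and> diameter (C i) \<le> d)}.
        \<Sum>i. hausdorff_weight k (C i))"

definition hausdorff_ae :: "nat \<Rightarrow> 'a::metric_space set \<Rightarrow> ('a \<Rightarrow> bool) \<Rightarrow> bool" where
  "hausdorff_ae k A P \<longleftrightarrow> hausdorff_measure k {x\<in>A. \<not> P x} = 0"

primrec Ck :: "nat \<Rightarrow> ('a::euclidean_space \<Rightarrow> real) \<Rightarrow> bool" where
  "Ck 0 f \<longleftrightarrow> continuous_on UNIV f"
| "Ck (Suc k) f \<longleftrightarrow> (\<forall>x. f differentiable (at x)) \<and>
     (\<forall>v. Ck k (\<lambda>x. frechet_derivative f (at x) v))"

definition test_function :: "'a::euclidean_space set \<Rightarrow> ('a \<Rightarrow> real) \<Rightarrow> bool" where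
  "test_function U \<psi> \<longleftrightarrow> (\<forall>k. Ck k \<psi>) \<and>
     compact (closure {x. \<psi> x \<noteq> 0}) \<and> closure {x. \<psi> x \<noteq> 0} \<subseteq> U"

text \<open>\<open>frechet_derivative \<psi> (at z) (\<phi> z)\<close> is \<open>\<phi>(z) \<bullet> \<nabla>\<psi>(z)\<close>.\<close>

definition weakly_divergence_free ::
    "'a::euclidean_space set \<Rightarrow> ('a \<Rightarrow> 'a) \<Rightarrow> bool" where
  "weakly_divergence_free U \<phi> \<longleftrightarrow>
     (\<forall>\<psi>. test_function U \<psi> \<longrightarrow> (LINT z:U|lborel. frechet_derivative \<psi> (at z) (\<phi> z)) = 0)"

definition half_ball :: "'a::euclidean_space \<Rightarrow> real \<Rightarrow> 'a \<Rightarrow> 'a set" where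
  "half_ball x \<rho> \<nu> = {y \<in> ball x \<rho>. (y - x) \<bullet> \<nu> > 0}"

text \<open>\<open>jump_triple u x a b \<nu>\<close>: \<open>x\<close> is a jump point of \<open>u\<close> with \<open>u\<^sup>-(x) = a\<close>, \<open>u\<^sup>+(x) = b\<close> and
  \<open>\<nu>\<^sub>u(x) = \<nu>\<close>. For locally integrable \<open>u\<close>, the triple is determined by \<open>x\<close> since \<open>a < b\<close>.\<close>

definition jump_triple ::
    "('a::euclidean_space \<Rightarrow> real) \<Rightarrow> 'a \<Rightarrow> real \<Rightarrow> real \<Rightarrow> 'a \<Rightarrow> bool" where
  "jump_triple u x a b \<nu> \<longleftrightarrow> a < b \<and> norm \<nu> = 1 \<and>
     ((\<lambda>\<rho>. (LINT y:half_ball x \<rho> \<nu>|lborel. \<bar>u y - b\<bar>) / measure lborel (half_ball x \<rho> \<nu>))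
        \<longlongrightarrow> 0) (at_right 0) \<and>
     ((\<lambda>\<rho>. (LINT y:half_ball x \<rho> (- \<nu>)|lborel. \<bar>u y - a\<bar>) / measure lborel (half_ball x \<rho> (- \<nu>)))
        \<longlongrightarrow> 0) (at_right 0)"

definition jump_set :: "('a::euclidean_space \<Rightarrow> real) \<Rightarrow> 'a set" where
  "jump_set u = {x. \<exists>a b \<nu>. jump_triple u x a b \<nu>}"

text \<open>\<open>sbv_gradient u g\<close>: \<open>u\<close> belongs to SBV of the whole space and \<open>g\<close> is (a representative of) its
  gradient \<open>\<nabla>u\<close>. That is, \<open>u\<close> is integrable, its distributional derivative is a finite vector
  measure \<open>Du\<close> with absolutely continuous part \<open>g dx\<close>, and its singular part, written in polar form
  as \<open>\<sigma> \<mu>\<close>, is concentrated on the jump set (no Cantor part). By uniqueness of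
  the Lebesgue decomposition \<open>g\<close> is determined almost everywhere.\<close>

definition sbv_gradient ::
    "('a::euclidean_space \<Rightarrow> real) \<Rightarrow> ('a \<Rightarrow> 'a) \<Rightarrow> bool" where
  "sbv_gradient u g \<longleftrightarrow> integrable lborel u \<and> integrable lborel g \<and>
     (\<exists>\<mu> \<sigma>. sets \<mu> = sets borel \<and> finite_measure \<mu> \<and>
        \<sigma> \<in> borel_measurable borel \<and> (AE x in \<mu>. norm (\<sigma> x) = 1) \<and>
        (\<exists>N\<in>null_sets lborel. AE x in \<mu>. x \<in> N) \<and>
        (AE x in \<mu>. x \<in> jump_set u) \<and>
        (\<forall>\<psi> v. test_function UNIV \<psi> \<longrightarrow>
           (LINT x|lborel. u x * frechet_derivative \<psi> (at x) v) =
             - ((LINT x|lborel. \<psi> x * (g x \<bullet> v)) + (LINT x|\<mu>. \<psi> x * (\<sigma> x \<bullet> v)))))"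

definition SBV :: "('a::euclidean_space \<Rightarrow> real) set" where
  "SBV = {u. \<exists>g. sbv_gradient u g}"

definition lipschitz_hypersurface :: "'a::euclidean_space set \<Rightarrow> bool" where
  "lipschitz_hypersurface S \<longleftrightarrow>
     (\<forall>z\<in>S. \<exists>U e f L. open U \<and> z \<in> U \<and> norm e = 1 \<and> L-lipschitz_on {y. y \<bullet> e = 0} f \<and>
        S \<inter> U = {y + f y *\<^sub>R e | y. y \<bullet> e = 0} \<inter> U)"

definition lipschitz_boundary :: "'a::euclidean_space set \<Rightarrow> bool" where
  "lipschitz_boundary \<Omega> \<longleftrightarrow>
     (\<forall>z\<in>frontier \<Omega>. \<exists>U e f L. open U \<and> z \<in> U \<and> norm e = 1 \<and> L-lipschitz_on {y. y \<bullet> e = 0} f \<and>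
        \<Omega> \<inter> U = {y + s *\<^sub>R e | y s. y \<bullet> e = 0 \<and> s < f y} \<inter> U)"

text \<open>\<open>\<nu>\<close> is a unit vector orthogonal to the tangent plane of \<open>S\<close> at \<open>z\<close>. On a Lipschitz graph such
  a \<open>\<nu>\<close> exists exactly at the points where the graph function is differentiable, hence almost
  everywhere, and it is then unique up to sign.\<close>

definition unit_normal_at :: "'a::euclidean_space set \<Rightarrow> 'a \<Rightarrow> 'a \<Rightarrow> bool" where
  "unit_normal_at S z \<nu> \<longleftrightarrow> norm \<nu> = 1 \<and>
     ((\<lambda>w. ((w - z) \<bullet> \<nu>) / norm (w - z)) \<longlongrightarrow> 0) (at z within S)"

definition density_zero_at :: "'a::euclidean_space set \<Rightarrow> 'a \<Rightarrow> bool" where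
  "density_zero_at E z \<longleftrightarrow>
     ((\<lambda>\<rho>. measure lebesgue (E \<inter> ball z \<rho>) / measure lebesgue (ball z \<rho>)) \<longlongrightarrow> 0) (at_right 0)"

text \<open>Both choices of the sign of the normal give the same condition, and the points without a
  normal form a null set (Rademacher), so quantifying over all unit normals at \<open>z\<^sub>0\<close> is
  the same as fixing a measurable unit normal field on \<open>S\<close>. The Hausdorff dimension is one less
  than the dimension of the ambient space.\<close>

definition approximately_regular ::
    "'a::euclidean_space set \<Rightarrow> ('a \<Rightarrow> 'a) \<Rightarrow> bool" where
  "approximately_regular D \<phi> \<longleftrightarrow>
     (\<forall>S. lipschitz_hypersurface S \<longrightarrow>
        hausdorff_ae (DIM('a) - 1) (S \<inter> D)
          (\<lambda>z0. \<forall>\<nu>. unit_normal_at S z0 \<nu> \<longrightarrow>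
             (\<forall>\<epsilon>>0. density_zero_at {z\<in>D. \<bar>(\<phi> z - \<phi> z0) \<bullet> \<nu>\<bar> > \<epsilon>} z0)))"

definition admissible :: "'a::euclidean_space set \<Rightarrow> ('a \<Rightarrow> real) \<Rightarrow> bool" where
  "admissible \<Omega> u \<longleftrightarrow> u \<in> SBV \<and> compact (closure {x. u x \<noteq> 0}) \<and>
     (\<forall>x\<in>\<Omega>. u x = 1) \<and> (\<forall>x. 0 \<le> u x \<and> u x \<le> 1)"

text \<open>The field \<open>\<phi>\<close> is a total function of which only the values on \<open>(- \<Omega>) \<times> {0..1}\<close> matter;
  \<open>\<phi>\<^sup>x = fst \<circ> \<phi>\<close> and \<open>\<phi>\<^sup>t = snd \<circ> \<phi>\<close>. The interval integrals are oriented. The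
  condition involving the gradient holds almost everywhere, so it does not depend on the
  representative \<open>g\<close>.\<close>

definition calibration ::
    "real \<Rightarrow> real \<Rightarrow> 'a::euclidean_space set \<Rightarrow> ('a \<Rightarrow> real) \<Rightarrow> ('a \<times> real \<Rightarrow> 'a \<times> real) \<Rightarrow> bool" where
  "calibration \<beta> \<gamma> \<Omega> u \<phi> \<longleftrightarrow>
     open \<Omega> \<and> bounded \<Omega> \<and> lipschitz_boundary \<Omega> \<and> admissible \<Omega> u \<and>
     \<phi> \<in> borel_measurable (restrict_space borel ((- \<Omega>) \<times> {0..1})) \<and>
     bounded (\<phi> ` ((- \<Omega>) \<times> {0..1})) \<and>
     approximately_regular ((- \<Omega>) \<times> {0..1}) \<phi> \<and>
     weakly_divergence_free ((- closure \<Omega>) \<times> {0<..<1}) \<phi> \<and>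
     (AE x in lborel. x \<notin> closure \<Omega> \<longrightarrow>
        (\<forall>t\<in>{0..1}. snd (\<phi> (x, t)) \<ge>
           1/4 * (norm (fst (\<phi> (x, t))))\<^sup>2 - \<gamma>\<^sup>2 * indicator {0<..} t)) \<and>
     hausdorff_ae (DIM('a) - 1) (- \<Omega>)
       (\<lambda>x. \<forall>r\<in>{0..1}. \<forall>s\<in>{0..1}.
          norm (LBINT t=ereal r..ereal s. fst (\<phi> (x, t))) \<le> \<beta> * (r\<^sup>2 + s\<^sup>2)) \<and>
     (\<exists>g. sbv_gradient u g \<and>
        (AE x in lborel. x \<notin> closure \<Omega> \<longrightarrow>
           fst (\<phi> (x, u x)) = 2 *\<^sub>R g x \<and>
           snd (\<phi> (x, u x)) = (norm (g x))\<^sup>2 - \<gamma>\<^sup>2 * indicator {0<..} (u x))) \<and>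
     hausdorff_ae (DIM('a) - 1) (jump_set u)
       (\<lambda>x. \<forall>a b \<nu>. jump_triple u x a b \<nu> \<longrightarrow>
          (LBINT t=ereal a..ereal b. fst (\<phi> (x, t))) = (\<beta> * (a\<^sup>2 + b\<^sup>2)) *\<^sub>R \<nu>)"

definition radial_Gamma :: "nat \<Rightarrow> real \<Rightarrow> real" where
  "radial_Gamma n r =
     (if n = 1 then r - 1
      else if n = 2 then ln r
      else 1 / (real n - 2) * (1 - r powr (2 - real n)))"

definition radial_delta :: "nat \<Rightarrow> real \<Rightarrow> real \<Rightarrow> real" where
  "radial_delta n \<beta> r = 1 / (1 + \<beta> * r ^ (n - 1) * radial_Gamma n r)"

definition radial_u :: "real \<Rightarrow> real \<Rightarrow> 'a::euclidean_space \<Rightarrow> real" where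
  "radial_u \<beta> R x =
     (if norm x \<le> 1 then 1
      else if norm x \<le> R then
        1 - \<beta> * radial_delta DIM('a) \<beta> R * R ^ (DIM('a) - 1) * radial_Gamma DIM('a) (norm x)
      else 0)"

end

theory Submission
  imports Defs
begin

text \<open>Write \<open>r = |x|\<close>, \<open>m = n - 1\<close>, \<open>\<delta> = \<delta>(R)\<close> for the value of \<open>u\<close> on the inner side of the sphere
  \<open>|x| = R\<close>, and \<open>\<kappa>(r) = \<delta> (R/r)^m\<close>. The calibration is the radial field
  \<open>\<phi>\<^sup>x = - 2 \<beta> min(t, \<kappa>(r)) x/r\<close>,
  \<open>\<phi>\<^sup>t = \<beta> m min(t, \<kappa>(r))\<^sup>2 / r + e(r)\<close>, with
  \<open>e(r) = max(0, (\<beta>\<^sup>2 - \<beta> m/r) \<kappa>(r)\<^sup>2 - \<gamma>\<^sup>2)\<close>.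

  The horizontal part is the field \<open>- 2 \<beta> t x/r\<close>, whose integral over \<open>[0, t]\<close> has the extremal length
  \<open>\<beta> t\<^sup>2\<close>, truncated at the height \<open>\<kappa>(r)\<close>. Its primitive \<open>V\<close> therefore has length between \<open>0\<close> and
  \<open>\<beta> t\<^sup>2\<close>, which gives condition (b), and \<open>\<kappa>(R) = \<delta>\<close> gives the equality (b') on the jump set, where
  the traces are \<open>0\<close> and \<open>\<delta>\<close>. The height \<open>\<kappa>\<close> is chosen so that \<open>\<beta> \<kappa>(r)\<close> is the slope
  \<open>|\<nabla>u|\<close> for \<open>1 < r < R\<close>. In this range the graph of \<open>u\<close> lies above \<open>\<kappa>\<close>
  (both functions equal \<open>\<delta>\<close> at \<open>R\<close>, and \<open>u\<close> decreases faster because \<open>\<beta> \<ge> m/r\<close>), so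
  \<open>\<phi>\<^sup>x = 2 \<nabla>u\<close> on the graph.

  Condition (a) amounts, for \<open>t > 0\<close>, to \<open>(\<beta>\<^sup>2 - \<beta> m/r) min(t, \<kappa>)\<^sup>2 - \<gamma>\<^sup>2 \<le> e(r)\<close>, which is built into
  the definition of \<open>e\<close>. The bound on \<open>\<beta>\<close> and the free boundary equation give the equality (a'): the quantity
  \<open>(\<beta>\<^sup>2 - \<beta> m/r) \<kappa>(r)\<^sup>2\<close> equals \<open>\<gamma>\<^sup>2\<close> at \<open>r = R\<close> by the free boundary equation, and it
  is nonincreasing on \<open>r \<ge> 1\<close> because \<open>\<beta> \<ge> n - 1/2\<close> (\<open>balance_antimono\<close>). Hence the maximum in \<open>e\<close> is
  attained by its second argument for \<open>r \<le> R\<close>, which makes \<open>\<phi>\<^sup>t = |\<nabla>u|\<^sup>2 - \<gamma>\<^sup>2\<close> on the graph, and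
  by \<open>0\<close> for \<open>r \<ge> R\<close>, which makes \<open>\<phi>\<close> vanish where \<open>u = 0\<close>.

  The field is continuous, so it is approximately regular for trivial reasons. It is divergence-free
  because the primitive \<open>V\<close> of \<open>\<phi>\<^sup>x\<close> in \<open>t\<close> is of class \<open>C\<^sup>1\<close> with \<open>\<phi>\<^sup>t = e - div V\<close>: after one
  integration by parts, \<open>(\<partial>\<^sub>t V, - div V)\<close> is tested against differences of mixed second
  derivatives (\<open>radial_field_weakly_divergence_free\<close>).

  It remains to see that \<open>u\<close> is an SBV function with the expected gradient and jump. The surface measure
  on the sphere of radius \<open>R\<close> is realized as a push-forward of Lebesgue measure under radial projection,
  the Gauss formula on the ball follows by a cutoff argument (\<open>divergence_theorem_cball\<close>), and
  the jump points and their traces are identified by blowing up (\<open>jump_triple_step\<close>).\<close>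

section \<open>Integration by parts along a direction\<close>

lemma integral_lborel_translate:
  fixes f :: "'a::euclidean_space \<Rightarrow> 'b::{banach, second_countable_topology}"
  assumes "f \<in> borel_measurable borel"
  shows "(LINT z|lborel. f (z + a)) = (LINT z|lborel. f z)"
proof -
  have "(LINT z|lborel. f z) = (LINT z|distr lborel borel ((+) a). f z)"
    by (simp add: lborel_distr_plus)
  also have "\<dots> = (LINT z|lborel. f (a + z))"
    using assms by (intro integral_distr) auto
  finally show ?thesis by (simp add: add.commute)
qed

lemma integral_lborel_scale:
  fixes f :: "'a::euclidean_space \<Rightarrow> real"
  assumes "f \<in> borel_measurable borel" "r > 0"
  shows "(LINT y|lborel. f y) = r ^ DIM('a) * (LINT z|lborel. f (x + r *\<^sub>R z))"
proof -
  have "(LINT y|lborel. f y) =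
      (LINT y|density (distr lborel borel (\<lambda>z. x + r *\<^sub>R z)) (\<lambda>_. ennreal (r ^ DIM('a))). f y)"
    using lborel_affine[of r x] assms(2) by (simp add: ennreal_power)
  also have "\<dots> = (LINT y|distr lborel borel (\<lambda>z. x + r *\<^sub>R z). r ^ DIM('a) * f y)"
    using assms by (subst integral_density) auto
  also have "\<dots> = (LINT z|lborel. r ^ DIM('a) * f (x + r *\<^sub>R z))"
    using assms by (subst integral_distr) auto
  finally show ?thesis by simp
qed

lemma integrable_lborel_bounded_support:
  fixes f :: "'a::euclidean_space \<Rightarrow> 'b::{banach, second_countable_topology}"
  assumes "f \<in> borel_measurable borel"
    and "\<And>x. x \<notin> cball 0 B \<Longrightarrow> f x = 0" and "\<And>x. norm (f x) \<le> M"
  shows "integrable lborel f"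
proof (rule Bochner_Integration.integrable_bound)
  show "integrable lborel (\<lambda>x::'a. M * indicator (cball 0 B) x :: real)"
    using emeasure_lborel_cball_finite[of "0::'a" B]
    by (intro integrable_mult_right integrable_real_indicator) auto
  show "AE x in lborel. norm (f x) \<le> norm (M * indicator (cball 0 B) x)"
  proof (rule AE_I2)
    fix x :: 'a
    show "norm (f x) \<le> norm (M * indicator (cball 0 B) x)"
      using assms(2)[of x] assms(3)[of x] by (cases "x \<in> cball 0 B") auto
  qed
qed (use assms in auto)

lemma null_sets_sphere: "sphere (0::'a::euclidean_space) r \<in> null_sets lborel"
  using negligible_sphere[of "0::'a" r]
  by (auto simp: null_sets_completion_iff negligible_iff_null_sets)

lemma AE_notin_sphere: "AE x in lborel. norm (x::'a::euclidean_space) \<noteq> r"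
  using AE_not_in[OF null_sets_sphere[of r]] by eventually_elim auto

text \<open>By translation invariance every difference quotient of \<open>G\<close> has integral zero. The Lipschitz bound
  dominates these quotients, so the same holds for their almost everywhere limit. Only almost everywhere
  differentiability enters, so that functions with kinks along spheres can be treated.\<close>

theorem integral_directional_derivative_eq_0:
  fixes G D :: "'a::euclidean_space \<Rightarrow> real"
  assumes cont: "continuous_on UNIV G"
    and supp: "\<And>z. z \<notin> cball 0 B \<Longrightarrow> G z = 0"
    and lip: "\<And>z h. \<bar>G (z + h *\<^sub>R v) - G z\<bar> \<le> L * \<bar>h\<bar>"
    and D: "D \<in> borel_measurable borel"
    and deriv: "AE z in lborel. ((\<lambda>s. G (z + s *\<^sub>R v)) has_real_derivative D z) (at 0)"
  shows "integrable lborel D" "(LINT z|lborel. D z) = 0"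
proof -
  define h where "h i = 1 / real (Suc i)" for i
  have h: "0 < h i" "h i \<le> 1" for i by (auto simp: h_def)
  have h0: "h \<longlonglongrightarrow> 0"
    unfolding h_def by (rule LIMSEQ_Suc[OF lim_1_over_n])
  define q where "q i z = (G (z + h i *\<^sub>R v) - G z) / h i" for i z
  have Gm[measurable]: "G \<in> borel_measurable borel"
    using cont by (rule borel_measurable_continuous_onI)
  have "bounded (G ` cball 0 B)"
    by (intro compact_imp_bounded compact_continuous_image continuous_on_subset[OF cont]) auto
  then obtain M0 where M0: "\<And>z. z \<in> cball 0 B \<Longrightarrow> \<bar>G z\<bar> \<le> M0"
    unfolding bounded_iff by (metis image_eqI real_norm_def)
  have M: "norm (G z) \<le> max M0 0" for z
    using M0[of z] supp[of z] by (cases "z \<in> cball 0 B") auto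
  have intG: "integrable lborel G"
    by (rule integrable_lborel_bounded_support[OF Gm supp M])
  have intGs: "integrable lborel (\<lambda>z. G (z + a))" for a
  proof -
    have "integrable (distr lborel borel ((+) a)) G" using intG by (simp add: lborel_distr_plus)
    then show ?thesis by (subst (asm) integrable_distr_eq) (auto simp: add.commute)
  qed
  have q0: "(LINT z|lborel. q i z) = 0" for i
  proof -
    have "(LINT z|lborel. q i z) = ((LINT z|lborel. G (z + h i *\<^sub>R v)) - (LINT z|lborel. G z)) / h i"
      unfolding q_def using intG intGs by (simp add: Bochner_Integration.integral_diff)
    also have "\<dots> = 0" by (subst integral_lborel_translate) auto
    finally show ?thesis .
  qed
  let ?w = "\<lambda>z::'a. L * indicator (cball 0 (B + norm v)) z :: real"
  have L0: "0 \<le> L" using lip[of 0 1] by auto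
  have conv: "AE z in lborel. (\<lambda>i. q i z) \<longlonglongrightarrow> D z"
    using deriv
  proof eventually_elim
    case (elim z)
    then have "((\<lambda>s. (G (z + s *\<^sub>R v) - G z) / s) \<longlongrightarrow> D z) (at 0)"
      by (simp add: DERIV_def)
    moreover have "filterlim h (at 0) sequentially"
      using h0 h by (auto simp: filterlim_at intro!: always_eventually) (metis less_irrefl)
    ultimately show ?case
      unfolding q_def by (rule filterlim_compose)
  qed
  have bound: "AE z in lborel. norm (q i z) \<le> ?w z" for i
  proof (rule AE_I2)
    fix z :: 'a
    show "norm (q i z) \<le> ?w z"
    proof (cases "z \<in> cball 0 (B + norm v)")
      case True
      then show ?thesis using lip[of z "h i"] h(1)[of i]
        by (auto simp: q_def divide_simps)
    next
      case False
      have "norm z \<le> norm (z + h i *\<^sub>R v) + norm (h i *\<^sub>R v)"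
        by (metis add_diff_cancel_right' norm_triangle_ineq4)
      moreover have "norm (h i *\<^sub>R v) \<le> norm v"
        using h[of i] by (auto intro!: mult_left_le_one_le)
      ultimately have "z + h i *\<^sub>R v \<notin> cball 0 B" using False by auto
      moreover have "z \<notin> cball 0 B" using False norm_ge_zero[of v] by (auto simp del: norm_ge_zero)
      ultimately show ?thesis using False supp by (simp add: q_def)
    qed
  qed
  have w: "integrable lborel ?w"
    using emeasure_lborel_cball_finite[of "0::'a" "B + norm v"]
    by (intro integrable_mult_right integrable_real_indicator) auto
  have qm: "q i \<in> borel_measurable lborel" for i
    unfolding q_def by measurable
  show "integrable lborel D"
    by (rule integrable_dominated_convergence[OF _ qm w conv bound]) (use D in auto)
  have "(\<lambda>i. LINT z|lborel. q i z) \<longlonglongrightarrow> (LINT z|lborel. D z)"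
    by (rule integral_dominated_convergence[OF _ qm w conv bound]) (use D in auto)
  then show "(LINT z|lborel. D z) = 0"
    unfolding q0 by (simp add: LIMSEQ_const_iff)
qed

lemma directional_derivative_shift:
  fixes F :: "'a::real_normed_vector \<Rightarrow> real"
  assumes "\<And>z. ((\<lambda>s. F (z + s *\<^sub>R v)) has_real_derivative F' z) (at 0)"
  shows "((\<lambda>s. F (z + s *\<^sub>R v)) has_real_derivative F' (z + r *\<^sub>R v)) (at r)"
proof -
  have "((\<lambda>s. F (z + r *\<^sub>R v + s *\<^sub>R v)) has_real_derivative F' (z + r *\<^sub>R v)) (at 0)"
    by (rule assms)
  then have "((\<lambda>s. F (z + (s + r) *\<^sub>R v)) has_real_derivative F' (z + r *\<^sub>R v)) (at 0)"
    by (simp add: algebra_simps)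
  then show ?thesis
    using DERIV_shift[of "\<lambda>s. F (z + s *\<^sub>R v)" "F' (z + r *\<^sub>R v)" 0 r] by simp
qed

text \<open>Lets a factor be singular away from the support of the other one; the radial potentials below
  are singular on the axis \<open>x = 0\<close>, which the supports of the test functions avoid.\<close>

lemma continuous_on_UNIV_mult_supported:
  fixes F \<eta> :: "'a::t2_space \<Rightarrow> real"
  assumes "open U" "compact C" "C \<subseteq> U" "continuous_on U F" "continuous_on UNIV \<eta>"
    and "\<And>z. z \<notin> C \<Longrightarrow> \<eta> z = 0"
  shows "continuous_on UNIV (\<lambda>z. F z * \<eta> z)"
proof -
  have "continuous_on (U \<union> - C) (\<lambda>z. F z * \<eta> z)"
  proof (rule continuous_on_open_Un)
    show "continuous_on U (\<lambda>z. F z * \<eta> z)"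
      using assms by (auto intro!: continuous_intros intro: continuous_on_subset)
    have "continuous_on (- C) (\<lambda>z. 0::real)" by simp
    then show "continuous_on (- C) (\<lambda>z. F z * \<eta> z)"
      by (rule continuous_on_eq) (use assms in auto)
  qed (use assms in \<open>auto simp: compact_imp_closed\<close>)
  moreover have "U \<union> - C = UNIV" using assms by auto
  ultimately show ?thesis by simp
qed

theorem integration_by_parts_direction:
  fixes F F' \<eta> \<eta>' :: "'a::euclidean_space \<Rightarrow> real"
  assumes U: "open U" "compact C" "C \<subseteq> U"
    and F: "continuous_on U F" "continuous_on U F'"
      "\<And>z. z \<in> U \<Longrightarrow> ((\<lambda>s. F (z + s *\<^sub>R v)) has_real_derivative F' z) (at 0)"
    and \<eta>: "continuous_on UNIV \<eta>" "continuous_on UNIV \<eta>'"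
      "\<And>z. ((\<lambda>s. \<eta> (z + s *\<^sub>R v)) has_real_derivative \<eta>' z) (at 0)"
    and supp: "\<And>z. z \<notin> C \<Longrightarrow> \<eta> z = 0"
  shows "integrable lborel (\<lambda>z. F' z * \<eta> z)" "integrable lborel (\<lambda>z. F z * \<eta>' z)"
    "(LINT z|lborel. F' z * \<eta> z) = - (LINT z|lborel. F z * \<eta>' z)"
proof -
  obtain B where B: "C \<subseteq> cball 0 B"
    using compact_imp_bounded[OF U(2)] unfolding bounded_iff by (auto simp: subset_iff)
  have near: "\<forall>\<^sub>F s in nhds 0. z + s *\<^sub>R v \<in> W" if "open W" "z \<in> W" for z W
  proof -
    have "continuous (at 0) (\<lambda>s::real. z + s *\<^sub>R v)" by (intro continuous_intros)
    then have "filterlim (\<lambda>s::real. z + s *\<^sub>R v) (nhds z) (nhds 0)"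
      using tendsto_at_iff_tendsto_nhds[of "\<lambda>s. z + s *\<^sub>R v" 0] by (simp add: continuous_at)
    then show ?thesis using eventually_nhds_in_open[OF that] unfolding filterlim_iff by blast
  qed
  have supp': "\<eta>' z = 0" if "z \<notin> C" for z
  proof -
    have "\<forall>\<^sub>F s in nhds 0. z + s *\<^sub>R v \<in> - C"
      using U that by (intro near) (auto simp: compact_imp_closed)
    then have "\<forall>\<^sub>F s in nhds 0. \<eta> (z + s *\<^sub>R v) = 0"
      by eventually_elim (use supp in auto)
    then have "((\<lambda>s. \<eta> (z + s *\<^sub>R v)) has_real_derivative 0) (at 0)"
      by (subst DERIV_cong_ev[OF refl _ refl]) auto
    then show ?thesis using \<eta>(3) DERIV_unique by blast
  qed
  define G where "G z = F z * \<eta> z" for z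
  define D where "D z = F' z * \<eta> z + F z * \<eta>' z" for z
  have c1: "continuous_on UNIV (\<lambda>z. F' z * \<eta> z)" and c2: "continuous_on UNIV (\<lambda>z. F z * \<eta>' z)"
    and cG: "continuous_on UNIV G"
    unfolding G_def using assms supp' by (auto intro!: continuous_on_UNIV_mult_supported[OF U])
  have cD: "continuous_on UNIV D" unfolding D_def by (intro continuous_intros c1 c2)
  have bdd: "\<exists>M. \<forall>z. norm (f z) \<le> M" if "continuous_on UNIV f" "\<And>z. z \<notin> C \<Longrightarrow> f z = 0"
    for f :: "'a \<Rightarrow> real"
  proof -
    have "bounded (f ` C)"
      by (intro compact_imp_bounded compact_continuous_image continuous_on_subset[OF that(1)]) (use U in auto)
    then obtain M0 where M0: "\<And>z. z \<in> C \<Longrightarrow> norm (f z) \<le> M0"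
      unfolding bounded_iff by auto
    then have "norm (f z) \<le> max M0 0" for z
      using M0[of z] that(2)[of z] by (cases "z \<in> C") (auto intro: max.coboundedI1)
    then show ?thesis by blast
  qed
  have int: "integrable lborel f" if f: "continuous_on UNIV f" "\<And>z. z \<notin> C \<Longrightarrow> f z = 0"
    for f :: "'a \<Rightarrow> real"
  proof -
    obtain M where "\<And>z. norm (f z) \<le> M" using bdd[OF f] by auto
    then show ?thesis
      using f B by (intro integrable_lborel_bounded_support[of f B M])
        (blast intro: borel_measurable_continuous_onI)+
  qed
  have i1: "integrable lborel (\<lambda>z. F' z * \<eta> z)" and i2: "integrable lborel (\<lambda>z. F z * \<eta>' z)"
    using supp supp' by (auto intro!: int c1 c2)
  show "integrable lborel (\<lambda>z. F' z * \<eta> z)" "integrable lborel (\<lambda>z. F z * \<eta>' z)"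
    by (fact i1 i2)+
  have deriv: "((\<lambda>s. G (z + s *\<^sub>R v)) has_real_derivative D z) (at 0)" for z
  proof (cases "z \<in> U")
    case True
    show ?thesis unfolding G_def D_def
      using DERIV_mult[OF F(3)[OF True] \<eta>(3)[of z]] by (simp add: algebra_simps)
  next
    case False
    then have z: "z \<notin> C" using U by auto
    have "\<forall>\<^sub>F s in nhds 0. z + s *\<^sub>R v \<in> - C"
      using U z by (intro near) (auto simp: compact_imp_closed)
    then have "\<forall>\<^sub>F s in nhds 0. G (z + s *\<^sub>R v) = 0"
      by eventually_elim (use supp in \<open>auto simp: G_def\<close>)
    then have "((\<lambda>s. G (z + s *\<^sub>R v)) has_real_derivative 0) (at 0)"
      by (subst DERIV_cong_ev[OF refl _ refl]) auto
    moreover have "D z = 0" using z supp supp' by (simp add: D_def)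
    ultimately show ?thesis by simp
  qed
  obtain M where M: "\<And>z. norm (D z) \<le> M"
    using bdd[OF cD] supp supp' by (auto simp: D_def)
  have lip: "\<bar>G (z + h *\<^sub>R v) - G z\<bar> \<le> M * \<bar>h\<bar>" for z h
  proof -
    have "norm (G (z + h *\<^sub>R v) - G (z + 0 *\<^sub>R v)) \<le> M * norm (h - 0)"
      by (rule field_differentiable_bound[of UNIV _ "\<lambda>r. D (z + r *\<^sub>R v)"])
        (use directional_derivative_shift[OF deriv] M in auto)
    then show ?thesis by simp
  qed
  have "(LINT z|lborel. D z) = 0"
  proof (rule integral_directional_derivative_eq_0(2)[OF cG _ lip])
    show "G z = 0" if "z \<notin> cball 0 B" for z
    proof -
      have "z \<notin> C" using that B by blast
      then show ?thesis using supp by (simp add: G_def)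
    qed
    show "D \<in> borel_measurable borel" using cD by (rule borel_measurable_continuous_onI)
  qed (use deriv in auto)
  then show "(LINT z|lborel. F' z * \<eta> z) = - (LINT z|lborel. F z * \<eta>' z)"
    unfolding D_def using i1 i2 by simp
qed

text \<open>Schwarz's theorem. The second difference of \<open>f\<close> over the parallelogram spanned by \<open>h a\<close> and \<open>h b\<close> is
  symmetric in \<open>a\<close> and \<open>b\<close>; applying the mean value theorem twice, in either order, writes it as \<open>h\<^sup>2\<close>
  times a value of either mixed derivative near \<open>z\<close>.\<close>

lemma mixed_directional_derivatives_commute:
  fixes f :: "'a::real_normed_vector \<Rightarrow> real"
  assumes fa: "\<And>z. ((\<lambda>s. f (z + s *\<^sub>R a)) has_real_derivative fa z) (at 0)"
    and fb: "\<And>z. ((\<lambda>s. f (z + s *\<^sub>R b)) has_real_derivative fb z) (at 0)"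
    and fab: "\<And>z. ((\<lambda>s. fa (z + s *\<^sub>R b)) has_real_derivative fab z) (at 0)"
    and fba: "\<And>z. ((\<lambda>s. fb (z + s *\<^sub>R a)) has_real_derivative fba z) (at 0)"
    and cont: "continuous_on UNIV fab" "continuous_on UNIV fba"
  shows "fab z = fba z"
proof -
  have key: "\<exists>s t. 0 \<le> s \<and> s \<le> h \<and> 0 \<le> t \<and> t \<le> h \<and>
      f (z + h *\<^sub>R a + h *\<^sub>R b) - f (z + h *\<^sub>R a) - f (z + h *\<^sub>R b) + f z = h * h * gab (z + s *\<^sub>R a + t *\<^sub>R b)"
    if h: "h > 0" and ga: "\<And>z. ((\<lambda>s. f (z + s *\<^sub>R a)) has_real_derivative ga z) (at 0)"
      and gab: "\<And>z. ((\<lambda>s. ga (z + s *\<^sub>R b)) has_real_derivative gab z) (at 0)"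
    for h :: real and a b ga gab
  proof -
    define p where "p s = f (z + h *\<^sub>R b + s *\<^sub>R a) - f (z + s *\<^sub>R a)" for s
    have "(p has_real_derivative ga (z + h *\<^sub>R b + s *\<^sub>R a) - ga (z + s *\<^sub>R a)) (at s)" for s
      unfolding p_def
      by (intro DERIV_diff directional_derivative_shift[of f a ga] ga)
    then obtain s where s: "0 < s" "s < h"
      "p h - p 0 = h * (ga (z + h *\<^sub>R b + s *\<^sub>R a) - ga (z + s *\<^sub>R a))"
      using MVT2[of 0 h p "\<lambda>s. ga (z + h *\<^sub>R b + s *\<^sub>R a) - ga (z + s *\<^sub>R a)"] h by auto
    have "((\<lambda>t. ga (z + s *\<^sub>R a + t *\<^sub>R b)) has_real_derivative gab (z + s *\<^sub>R a + t *\<^sub>R b)) (at t)" for t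
      by (intro directional_derivative_shift[of ga b gab] gab)
    then obtain t where t: "0 < t" "t < h"
      "ga (z + s *\<^sub>R a + h *\<^sub>R b) - ga (z + s *\<^sub>R a + 0 *\<^sub>R b) = h * gab (z + s *\<^sub>R a + t *\<^sub>R b)"
      using MVT2[of 0 h "\<lambda>t. ga (z + s *\<^sub>R a + t *\<^sub>R b)" "\<lambda>t. gab (z + s *\<^sub>R a + t *\<^sub>R b)"] h by auto
    show ?thesis
      by (rule exI[of _ s], rule exI[of _ t]) (use s t in \<open>auto simp: p_def algebra_simps\<close>)
  qed
  define h where "h i = 1 / real (Suc i)" for i
  have h: "0 < h i" for i by (auto simp: h_def)
  have h0: "h \<longlonglongrightarrow> 0"
    unfolding h_def by (rule LIMSEQ_Suc[OF lim_1_over_n])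
  have "\<exists>s t s' t'. 0 \<le> s \<and> s \<le> h i \<and> 0 \<le> t \<and> t \<le> h i \<and> 0 \<le> s' \<and> s' \<le> h i \<and> 0 \<le> t' \<and> t' \<le> h i \<and>
      fab (z + s *\<^sub>R a + t *\<^sub>R b) = fba (z + s' *\<^sub>R b + t' *\<^sub>R a)" for i
  proof -
    from key[OF h[of i] fa fab] obtain s t where st: "0 \<le> s" "s \<le> h i" "0 \<le> t" "t \<le> h i"
      "f (z + h i *\<^sub>R a + h i *\<^sub>R b) - f (z + h i *\<^sub>R a) - f (z + h i *\<^sub>R b) + f z = h i * h i * fab (z + s *\<^sub>R a + t *\<^sub>R b)"
      by blast
    from key[OF h[of i] fb fba] obtain s' t' where st': "0 \<le> s'" "s' \<le> h i" "0 \<le> t'" "t' \<le> h i"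
      "f (z + h i *\<^sub>R b + h i *\<^sub>R a) - f (z + h i *\<^sub>R b) - f (z + h i *\<^sub>R a) + f z = h i * h i * fba (z + s' *\<^sub>R b + t' *\<^sub>R a)"
      by blast
    have "h i * h i * fab (z + s *\<^sub>R a + t *\<^sub>R b) = h i * h i * fba (z + s' *\<^sub>R b + t' *\<^sub>R a)"
      unfolding st(5)[symmetric] st'(5)[symmetric] by (simp add: add.commute add.left_commute)
    with h[of i] have "fab (z + s *\<^sub>R a + t *\<^sub>R b) = fba (z + s' *\<^sub>R b + t' *\<^sub>R a)" by simp
    with st st' show ?thesis by blast
  qed
  then obtain s t s' t' where st: "\<And>i. 0 \<le> s i \<and> s i \<le> h i" "\<And>i. 0 \<le> t i \<and> t i \<le> h i"
      "\<And>i. 0 \<le> s' i \<and> s' i \<le> h i" "\<And>i. 0 \<le> t' i \<and> t' i \<le> h i"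
      "\<And>i. fab (z + s i *\<^sub>R a + t i *\<^sub>R b) = fba (z + s' i *\<^sub>R b + t' i *\<^sub>R a)"
    by metis
  have lim0: "r \<longlonglongrightarrow> 0" if "\<And>i. 0 \<le> r i \<and> r i \<le> h i" for r
    by (rule tendsto_sandwich[OF _ _ tendsto_const h0]) (use that in auto)
  have "(\<lambda>i. fab (z + s i *\<^sub>R a + t i *\<^sub>R b)) \<longlonglongrightarrow> fab (z + 0 *\<^sub>R a + 0 *\<^sub>R b)"
    using st lim0 by (intro continuous_on_tendsto_compose[OF cont(1)] tendsto_intros) auto
  moreover have "(\<lambda>i. fba (z + s' i *\<^sub>R b + t' i *\<^sub>R a)) \<longlonglongrightarrow> fba (z + 0 *\<^sub>R b + 0 *\<^sub>R a)"
    using st lim0 by (intro continuous_on_tendsto_compose[OF cont(2)] tendsto_intros) auto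
  ultimately show ?thesis
    unfolding st(5) using LIMSEQ_unique by fastforce
qed

section \<open>Derivatives of test functions\<close>

lemma Ck_continuous: "Ck k f \<Longrightarrow> continuous_on UNIV f"
  by (cases k) (auto intro!: continuous_at_imp_continuous_on differentiable_imp_continuous_within)

lemma has_directional_derivative:
  fixes f :: "'a::real_normed_vector \<Rightarrow> real"
  assumes "f differentiable (at z)"
  shows "((\<lambda>s. f (z + s *\<^sub>R v)) has_real_derivative frechet_derivative f (at z) v) (at 0)"
proof -
  have f: "(f has_derivative frechet_derivative f (at z)) (at (z + 0 *\<^sub>R v))"
    using assms by (simp add: frechet_derivative_works)
  have g: "((\<lambda>s::real. z + s *\<^sub>R v) has_derivative (\<lambda>s. s *\<^sub>R v)) (at 0)"
    by (auto intro!: derivative_eq_intros)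
  have "((\<lambda>s. f (z + s *\<^sub>R v)) has_derivative (\<lambda>s. frechet_derivative f (at z) (s *\<^sub>R v))) (at 0)"
    by (rule has_derivative_compose[OF g f])
  moreover have "frechet_derivative f (at z) (s *\<^sub>R v) = frechet_derivative f (at z) v * s" for s
    using linear_frechet_derivative[OF assms] by (simp add: linear_scale)
  ultimately show ?thesis by (simp add: has_field_derivative_def)
qed

lemma test_functionD:
  assumes "test_function U \<psi>"
  shows "Ck k \<psi>" "\<psi> differentiable (at z)" "Ck k (\<lambda>x. frechet_derivative \<psi> (at x) v)"
    "continuous_on UNIV \<psi>" "continuous_on UNIV (\<lambda>x. frechet_derivative \<psi> (at x) v)"
    "((\<lambda>s. \<psi> (z + s *\<^sub>R v)) has_real_derivative frechet_derivative \<psi> (at z) v) (at 0)"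
    "(\<lambda>x. frechet_derivative \<psi> (at x) v) differentiable (at z)"
    "z \<notin> closure {x. \<psi> x \<noteq> 0} \<Longrightarrow> \<psi> z = 0"
    "z \<notin> closure {x. \<psi> x \<noteq> 0} \<Longrightarrow> frechet_derivative \<psi> (at z) v = 0"
proof -
  have all: "Ck k \<psi>" for k using assms by (simp add: test_function_def)
  show "Ck k \<psi>" by (rule all)
  from all[of "Suc k" for k] have *: "\<psi> differentiable (at z)"
    "Ck k (\<lambda>x. frechet_derivative \<psi> (at x) v)" for z v k by auto
  show "\<psi> differentiable (at z)" "Ck k (\<lambda>x. frechet_derivative \<psi> (at x) v)" by (fact *)+
  show "continuous_on UNIV \<psi>" "continuous_on UNIV (\<lambda>x. frechet_derivative \<psi> (at x) v)"
    using all *(2) Ck_continuous by blast+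
  show "((\<lambda>s. \<psi> (z + s *\<^sub>R v)) has_real_derivative frechet_derivative \<psi> (at z) v) (at 0)"
    using * by (intro has_directional_derivative)
  from *(2)[of "Suc 0" v] show "(\<lambda>x. frechet_derivative \<psi> (at x) v) differentiable (at z)"
    by simp
  show "\<psi> z = 0" if "z \<notin> closure {x. \<psi> x \<noteq> 0}"
    using that closure_subset[of "{x. \<psi> x \<noteq> 0}"] by auto
  assume z: "z \<notin> closure {x. \<psi> x \<noteq> 0}"
  have "(\<psi> has_derivative (\<lambda>_. 0)) (at z)"
  proof (rule has_derivative_transform_within_open[of "\<lambda>_. 0"])
    show "open (- closure {x. \<psi> x \<noteq> 0})" by auto
    show "0 = \<psi> x" if "x \<in> - closure {x. \<psi> x \<noteq> 0}" for x
      using that closure_subset[of "{x. \<psi> x \<noteq> 0}"] by auto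
  qed (use z in auto)
  then show "frechet_derivative \<psi> (at z) v = 0"
    by (simp add: frechet_derivative_at[symmetric])
qed

lemma test_function_mixed_derivatives_commute:
  assumes "test_function U \<psi>"
  shows "frechet_derivative (\<lambda>x. frechet_derivative \<psi> (at x) a) (at z) b =
    frechet_derivative (\<lambda>x. frechet_derivative \<psi> (at x) b) (at z) a"
proof (rule mixed_directional_derivatives_commute[where f = \<psi> and a = a and b = b
      and fa = "\<lambda>z. frechet_derivative \<psi> (at z) a" and fb = "\<lambda>z. frechet_derivative \<psi> (at z) b"
      and fab = "\<lambda>z. frechet_derivative (\<lambda>x. frechet_derivative \<psi> (at x) a) (at z) b"
      and fba = "\<lambda>z. frechet_derivative (\<lambda>x. frechet_derivative \<psi> (at x) b) (at z) a"])
  have "Ck 0 (\<lambda>x. frechet_derivative (\<lambda>x. frechet_derivative \<psi> (at x) a) (at x) b)" for a b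
    using test_functionD(3)[OF assms, of "Suc 0" a] by auto
  then show "continuous_on UNIV (\<lambda>z. frechet_derivative (\<lambda>x. frechet_derivative \<psi> (at x) a) (at z) b)"
    "continuous_on UNIV (\<lambda>z. frechet_derivative (\<lambda>x. frechet_derivative \<psi> (at x) b) (at z) a)" by auto
qed (use has_directional_derivative[OF test_functionD(7)[OF assms]] test_functionD(6)[OF assms] in auto)

text \<open>The operator norm of the derivative is at most the sum of the suprema of the partial derivatives, which
  are continuous with compact support.\<close>

lemma test_function_lipschitz:
  fixes \<psi> :: "'a::euclidean_space \<Rightarrow> real"
  assumes test: "test_function U \<psi>"
  obtains L M where "0 \<le> L" "\<And>x y. \<bar>\<psi> x - \<psi> y\<bar> \<le> L * norm (x - y)" "0 \<le> M" "\<And>x. \<bar>\<psi> x\<bar> \<le> M"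
proof -
  note td = test_functionD[OF test]
  define C where "C = closure {x. \<psi> x \<noteq> 0}"
  have C: "compact C" using test by (simp add: test_function_def C_def)
  have bdd: "\<exists>M\<ge>0. \<forall>z. \<bar>f z\<bar> \<le> M" if "continuous_on UNIV f" "\<And>z. z \<notin> C \<Longrightarrow> f z = 0"
    for f :: "'a \<Rightarrow> real"
  proof -
    have "bounded (f ` C)"
      by (intro compact_imp_bounded compact_continuous_image continuous_on_subset[OF that(1)]) (use C in auto)
    then obtain M0 where M0: "\<And>z. z \<in> C \<Longrightarrow> \<bar>f z\<bar> \<le> M0"
      unfolding bounded_iff by (metis image_eqI real_norm_def)
    have "\<bar>f z\<bar> \<le> max M0 0" for z
      using M0[of z] that(2)[of z] by (cases "z \<in> C") (auto intro: max.coboundedI1)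
    then show ?thesis by (intro exI[of _ "max M0 0"]) auto
  qed
  have "\<exists>M\<ge>0. \<forall>z. \<bar>\<psi> z\<bar> \<le> M"
    by (rule bdd[OF td(4)]) (use td(8) in \<open>unfold C_def, blast\<close>)
  then obtain M where M: "0 \<le> M" "\<And>z. \<bar>\<psi> z\<bar> \<le> M" by auto
  have "\<exists>M\<ge>0. \<forall>z. \<bar>frechet_derivative \<psi> (at z) i\<bar> \<le> M" for i
    by (rule bdd[OF td(5)]) (use td(9) in \<open>unfold C_def, blast\<close>)
  then obtain B where B: "\<And>i. 0 \<le> B i" "\<And>i z. \<bar>frechet_derivative \<psi> (at z) i\<bar> \<le> B i" by metis
  have "\<bar>\<psi> x - \<psi> y\<bar> \<le> (\<Sum>i\<in>Basis. B i) * norm (x - y)" for x y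
  proof -
    have "norm (\<psi> x - \<psi> y) \<le> (\<Sum>i\<in>Basis. B i) * norm (x - y)"
    proof (rule differentiable_bound[of UNIV \<psi> "\<lambda>z. frechet_derivative \<psi> (at z)"])
      show "(\<psi> has_derivative frechet_derivative \<psi> (at z)) (at z within UNIV)" for z
        using td(2) by (simp add: frechet_derivative_works)
      show "onorm (frechet_derivative \<psi> (at z)) \<le> (\<Sum>i\<in>Basis. B i)" for z
      proof (rule onorm_bound)
        show "0 \<le> (\<Sum>i\<in>(Basis::'a set). B i)" using B by (intro sum_nonneg) auto
        fix h :: 'a
        have lin: "linear (frechet_derivative \<psi> (at z))" by (rule linear_frechet_derivative[OF td(2)])
        have "frechet_derivative \<psi> (at z) h = frechet_derivative \<psi> (at z) (\<Sum>i\<in>Basis. (h \<bullet> i) *\<^sub>R i)"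
          by (simp add: euclidean_representation)
        also have "\<dots> = (\<Sum>i\<in>Basis. (h \<bullet> i) * frechet_derivative \<psi> (at z) i)"
          by (simp add: linear_sum[OF lin] linear_scale[OF lin])
        also have "norm \<dots> \<le> (\<Sum>i\<in>Basis. norm h * B i)"
        proof (rule order_trans[OF norm_sum sum_mono])
          fix i :: 'a assume i: "i \<in> Basis"
          show "norm ((h \<bullet> i) * frechet_derivative \<psi> (at z) i) \<le> norm h * B i"
            using Basis_le_norm[OF i, of h] B by (auto simp: abs_mult intro!: mult_mono)
        qed
        also have "\<dots> = (\<Sum>i\<in>Basis. B i) * norm h" by (simp add: sum_distrib_left mult.commute)
        finally show "norm (frechet_derivative \<psi> (at z) h) \<le> (\<Sum>i\<in>Basis. B i) * norm h" .
      qed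
    qed auto
    then show ?thesis by simp
  qed
  moreover have "0 \<le> (\<Sum>i\<in>(Basis::'a set). B i)" using B by (intro sum_nonneg) auto
  ultimately show ?thesis using that M by blast
qed

section \<open>Blow-ups at jump points\<close>

lemma half_ball_scale:
  assumes "r > 0"
  shows "x + r *\<^sub>R z \<in> half_ball x r \<nu> \<longleftrightarrow> z \<in> half_ball 0 1 \<nu>"
  using assms by (auto simp: half_ball_def dist_norm zero_less_mult_iff)

lemma open_half_ball: "open (half_ball x r \<nu>)"
proof -
  have "half_ball x r \<nu> = ball x r \<inter> {y. (y - x) \<bullet> \<nu> > 0}" by (auto simp: half_ball_def)
  also have "open \<dots>" by (intro open_Int open_ball open_Collect_less continuous_intros)
  finally show ?thesis .
qed

lemma half_ball_measurable[measurable]: "half_ball x r \<nu> \<in> sets borel"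
  by (simp add: open_half_ball)

lemma bounded_half_ball: "bounded (half_ball x r \<nu>)"
  by (rule bounded_subset[OF bounded_ball[of x r]]) (auto simp: half_ball_def)

text \<open>Turns an almost everywhere statement into one at a point of a prescribed open region; this is how
  the traces of a blow-up limit are read off.\<close>

lemma open_AE_ex:
  fixes W :: "'a::euclidean_space set"
  assumes "open W" "W \<noteq> {}" "AE z in lborel. P z"
  shows "\<exists>z\<in>W. P z"
proof (rule ccontr)
  assume "\<not> ?thesis"
  with assms(3) have "AE z in lborel. z \<notin> W" by auto
  moreover have "W \<in> sets lborel" using assms(1) by simp
  ultimately have "W \<in> null_sets lborel" by (simp add: AE_iff_null_sets)
  then have "negligible W" by (simp add: negligible_iff_null_sets null_sets_completionI)
  then show False using open_not_negligible assms by auto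
qed

lemma measure_half_ball_pos:
  assumes "norm \<nu> = 1"
  shows "measure lborel (half_ball (0::'a::euclidean_space) 1 \<nu>) > 0"
proof -
  have "\<nu> \<bullet> \<nu> = 1" using assms by (simp add: dot_square_norm)
  then have ne: "(1/2) *\<^sub>R \<nu> \<in> half_ball 0 1 \<nu>" using assms by (auto simp: half_ball_def)
  have fin: "emeasure lborel (half_ball (0::'a) 1 \<nu>) < \<infinity>"
    by (intro emeasure_bounded_finite bounded_half_ball)
  have "emeasure lborel (half_ball (0::'a) 1 \<nu>) \<noteq> 0"
  proof
    assume "emeasure lborel (half_ball (0::'a) 1 \<nu>) = 0"
    then have "half_ball (0::'a) 1 \<nu> \<in> null_sets lborel" by auto
    then have "AE z in lborel. z \<notin> half_ball (0::'a) 1 \<nu>" by (rule AE_not_in)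
    then show False using open_AE_ex[OF open_half_ball] ne by blast
  qed
  then show ?thesis using fin by (simp add: measure_def enn2real_positive_iff less_top[symmetric] zero_less_iff_neq_zero)
qed

definition half_ball_average :: "('a::euclidean_space \<Rightarrow> real) \<Rightarrow> 'a \<Rightarrow> real \<Rightarrow> 'a \<Rightarrow> real" where
  "half_ball_average f x r \<nu> = (LINT y:half_ball x r \<nu>|lborel. f y) / measure lborel (half_ball x r \<nu>)"

lemma half_ball_average_scale:
  fixes f :: "'a::euclidean_space \<Rightarrow> real"
  assumes [measurable]: "f \<in> borel_measurable borel" and r: "r > 0"
  shows "half_ball_average f x r \<nu> = half_ball_average (\<lambda>z. f (x + r *\<^sub>R z)) 0 1 \<nu>"
proof -
  have ind: "indicator (half_ball x r \<nu>) (x + r *\<^sub>R z) = (indicator (half_ball 0 1 \<nu>) z :: real)" for z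
    by (simp add: indicator_def half_ball_scale[OF r])
  have "(LINT y:half_ball x r \<nu>|lborel. f y) =
      r ^ DIM('a) * (LINT z:half_ball 0 1 \<nu>|lborel. f (x + r *\<^sub>R z))"
    unfolding set_lebesgue_integral_def
    by (subst integral_lborel_scale[OF _ r, of _ x]) (auto simp: ind)
  moreover have "measure lborel (half_ball x r \<nu>) = r ^ DIM('a) * measure lborel (half_ball (0::'a) 1 \<nu>)"
    using integral_lborel_scale[OF _ r, of "indicator (half_ball x r \<nu>)" x] by (simp add: ind)
  ultimately show ?thesis using r by (simp add: half_ball_average_def)
qed

text \<open>After rescaling to the unit half-ball the averages are integrals over a fixed domain, so dominated
  convergence reduces them to the pointwise blow-up limit \<open>u0\<close>.\<close>

lemma half_ball_average_tendsto:
  fixes u u0 :: "'a::euclidean_space \<Rightarrow> real"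
  assumes [measurable]: "u \<in> borel_measurable borel" "u0 \<in> borel_measurable borel"
    and bound: "\<And>y. \<bar>u y\<bar> \<le> M"
    and lim: "AE z in lborel. ((\<lambda>r. u (x + r *\<^sub>R z)) \<longlongrightarrow> u0 z) (at_right 0)"
  shows "((\<lambda>r. half_ball_average (\<lambda>y. \<bar>u y - b\<bar>) x r \<nu>)
    \<longlongrightarrow> half_ball_average (\<lambda>z. \<bar>u0 z - b\<bar>) 0 1 \<nu>) (at_right 0)"
  unfolding tendsto_at_iff_sequentially comp_def
proof (intro allI impI)
  fix X :: "nat \<Rightarrow> real"
  assume X: "\<forall>i. X i \<in> {0<..} - {0}" "X \<longlonglongrightarrow> 0"
  have fl: "filterlim X (at_right 0) sequentially"
    using X by (auto simp: filterlim_at intro!: always_eventually) (metis less_irrefl)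
  let ?H = "half_ball (0::'a) 1 \<nu>"
  have "(\<lambda>i. LINT z|lborel. indicator ?H z *\<^sub>R \<bar>u (x + X i *\<^sub>R z) - b\<bar>)
      \<longlonglongrightarrow> (LINT z|lborel. indicator ?H z *\<^sub>R \<bar>u0 z - b\<bar>)"
  proof (rule integral_dominated_convergence[where w = "\<lambda>z. (M + \<bar>b\<bar>) * indicator ?H z"])
    have "emeasure lborel ?H < \<infinity>"
      by (intro emeasure_bounded_finite bounded_half_ball)
    then show "integrable lborel (\<lambda>z. (M + \<bar>b\<bar>) * indicator ?H z)"
      by (intro integrable_mult_right integrable_real_indicator) auto
    show "AE z in lborel. (\<lambda>i. indicator ?H z *\<^sub>R \<bar>u (x + X i *\<^sub>R z) - b\<bar>) \<longlonglongrightarrow> indicator ?H z *\<^sub>R \<bar>u0 z - b\<bar>"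
      using lim
    proof eventually_elim
      case (elim z)
      show ?case by (intro tendsto_intros filterlim_compose[OF elim fl])
    qed
    show "AE z in lborel. norm (indicator ?H z *\<^sub>R \<bar>u (x + X i *\<^sub>R z) - b\<bar>) \<le> (M + \<bar>b\<bar>) * indicator ?H z" for i
    proof (rule AE_I2)
      fix z show "norm (indicator ?H z *\<^sub>R \<bar>u (x + X i *\<^sub>R z) - b\<bar>) \<le> (M + \<bar>b\<bar>) * indicator ?H z"
        using bound[of "x + X i *\<^sub>R z"] by (auto simp: indicator_def)
    qed
  qed auto
  then have "(\<lambda>i. half_ball_average (\<lambda>z. \<bar>u (x + X i *\<^sub>R z) - b\<bar>) 0 1 \<nu>)
      \<longlonglongrightarrow> half_ball_average (\<lambda>z. \<bar>u0 z - b\<bar>) 0 1 \<nu>"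
    unfolding half_ball_average_def set_lebesgue_integral_def divide_inverse
    by (intro tendsto_mult tendsto_const)
  moreover have "half_ball_average (\<lambda>y. \<bar>u y - b\<bar>) x (X i) \<nu> =
      half_ball_average (\<lambda>z. \<bar>u (x + X i *\<^sub>R z) - b\<bar>) 0 1 \<nu>" for i
    using X by (intro half_ball_average_scale) auto
  ultimately show "(\<lambda>i. half_ball_average (\<lambda>y. \<bar>u y - b\<bar>) x (X i) \<nu>)
      \<longlonglongrightarrow> half_ball_average (\<lambda>z. \<bar>u0 z - b\<bar>) 0 1 \<nu>" by simp
qed

lemma half_ball_average_eq_0D:
  fixes f :: "'a::euclidean_space \<Rightarrow> real"
  assumes [measurable]: "f \<in> borel_measurable borel" and f: "\<And>z. 0 \<le> f z" "\<And>z. f z \<le> M"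
    and "norm \<nu> = 1" "half_ball_average f 0 1 \<nu> = 0"
  shows "AE z in lborel. z \<in> half_ball 0 1 \<nu> \<longrightarrow> f z = 0"
proof -
  let ?H = "half_ball (0::'a) 1 \<nu>"
  have "(LINT z|lborel. indicator ?H z * f z) = 0"
    using assms(5) measure_half_ball_pos[OF assms(4)]
    by (auto simp: half_ball_average_def set_lebesgue_integral_def)
  moreover have "integrable lborel (\<lambda>z. indicator ?H z * f z)"
    using f by (intro integrable_lborel_bounded_support[of _ 1 M])
      (auto simp: indicator_def half_ball_def intro: order_trans)
  ultimately have "AE z in lborel. indicator ?H z * f z = 0"
    using f by (subst (asm) integral_nonneg_eq_0_iff_AE) auto
  then show ?thesis by eventually_elim auto
qed

lemma jump_triple_blowup:
  fixes u u0 :: "'a::euclidean_space \<Rightarrow> real"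
  assumes m[measurable]: "u \<in> borel_measurable borel" "u0 \<in> borel_measurable borel"
    and bound: "\<And>y. \<bar>u y\<bar> \<le> M" "\<And>y. \<bar>u0 y\<bar> \<le> M"
    and lim: "AE z in lborel. ((\<lambda>r. u (x + r *\<^sub>R z)) \<longlongrightarrow> u0 z) (at_right 0)"
    and jump: "jump_triple u x a b \<nu>"
  shows "AE z in lborel. z \<in> half_ball 0 1 \<nu> \<longrightarrow> u0 z = b"
    "AE z in lborel. z \<in> half_ball 0 1 (- \<nu>) \<longrightarrow> u0 z = a"
proof -
  have *: "AE z in lborel. z \<in> half_ball 0 1 \<nu>' \<longrightarrow> u0 z = c"
    if "norm \<nu>' = 1" "((\<lambda>r. half_ball_average (\<lambda>y. \<bar>u y - c\<bar>) x r \<nu>') \<longlongrightarrow> 0) (at_right 0)" for \<nu>' c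
  proof -
    have "half_ball_average (\<lambda>z. \<bar>u0 z - c\<bar>) 0 1 \<nu>' = 0"
      using tendsto_unique[OF _ half_ball_average_tendsto[OF m bound(1) lim] that(2)] by simp
    then have "AE z in lborel. z \<in> half_ball 0 1 \<nu>' \<longrightarrow> \<bar>u0 z - c\<bar> = 0"
      using that(1) bound(2) abs_triangle_ineq4 by (intro half_ball_average_eq_0D[where M = "M + \<bar>c\<bar>"])
        (auto intro: order_trans[OF abs_triangle_ineq4] add_right_mono)
    then show ?thesis by eventually_elim auto
  qed
  show "AE z in lborel. z \<in> half_ball 0 1 \<nu> \<longrightarrow> u0 z = b"
    "AE z in lborel. z \<in> half_ball 0 1 (- \<nu>) \<longrightarrow> u0 z = a"
    using jump by (auto simp: jump_triple_def half_ball_average_def intro!: *)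
qed

lemma inner_unit_less_1:
  assumes "norm \<nu> = 1" "norm \<nu>0 = 1" "\<nu> \<noteq> (\<nu>0::'a::real_inner)"
  shows "\<nu> \<bullet> \<nu>0 < 1"
proof -
  have "0 < (\<nu> - \<nu>0) \<bullet> (\<nu> - \<nu>0)" using assms by simp
  also have "\<dots> = 2 - 2 * (\<nu> \<bullet> \<nu>0)"
    using assms unfolding inner_diff_left inner_diff_right
    by (simp add: inner_commute[of \<nu>0] dot_square_norm)
  finally show ?thesis by simp
qed

text \<open>Two half-balls with normals that are not opposite overlap: a multiple of \<open>\<nu> + \<nu>0\<close> lies in both.\<close>

lemma half_ball_point:
  assumes "norm \<nu> = 1" "norm \<nu>0 = 1" "\<nu> \<noteq> - (\<nu>0::'a::euclidean_space)"
  shows "open (half_ball 0 1 \<nu> \<inter> {z. z \<bullet> \<nu>0 > 0})" "half_ball 0 1 \<nu> \<inter> {z. z \<bullet> \<nu>0 > 0} \<noteq> {}"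
proof -
  show "open (half_ball 0 1 \<nu> \<inter> {z. z \<bullet> \<nu>0 > 0})"
    by (intro open_Int open_half_ball open_Collect_less continuous_intros)
  have pos: "0 < 1 + \<nu> \<bullet> \<nu>0"
    using inner_unit_less_1[of \<nu> "- \<nu>0"] assms by simp
  have "\<nu> \<bullet> \<nu> = 1" "\<nu>0 \<bullet> \<nu>0 = 1" using assms by (simp_all add: dot_square_norm)
  then have "(\<nu> + \<nu>0) \<bullet> \<nu> > 0" "(\<nu> + \<nu>0) \<bullet> \<nu>0 > 0"
    using pos inner_commute[of \<nu> \<nu>0] by (simp_all add: inner_add_left)
  moreover have "norm (\<nu> + \<nu>0) \<le> 2" using norm_triangle_ineq[of \<nu> \<nu>0] assms by simp
  ultimately have "(1/3) *\<^sub>R (\<nu> + \<nu>0) \<in> half_ball 0 1 \<nu> \<inter> {z. z \<bullet> \<nu>0 > 0}"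
    unfolding half_ball_def by (simp del: scaleR_add_right)
  then show "half_ball 0 1 \<nu> \<inter> {z. z \<bullet> \<nu>0 > 0} \<noteq> {}" by blast
qed

text \<open>If the blow-up is a step function, its two values and its normal are the only possible jump data. Were
  \<open>\<nu> \<noteq> \<nu>0\<close>, the half-ball of \<open>\<nu>\<close> would meet the low side of the step and that of \<open>- \<nu>\<close> the high
  side, which forces \<open>b = a0 < b0 = a\<close>.\<close>

lemma jump_triple_step:
  fixes u :: "'a::euclidean_space \<Rightarrow> real"
  assumes m[measurable]: "u \<in> borel_measurable borel" and bound: "\<And>y. \<bar>u y\<bar> \<le> M"
    and \<nu>0: "norm \<nu>0 = 1" and ab: "a0 < b0"
    and lim: "AE z in lborel. ((\<lambda>r. u (x + r *\<^sub>R z)) \<longlongrightarrow> (if z \<bullet> \<nu>0 > 0 then b0 else a0)) (at_right 0)"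
  shows "jump_triple u x a b \<nu> \<longleftrightarrow> a = a0 \<and> b = b0 \<and> \<nu> = \<nu>0"
proof
  define u0 where "u0 z = (if z \<bullet> \<nu>0 > 0 then b0 else a0)" for z
  have u0m: "u0 \<in> borel_measurable borel" unfolding u0_def by measurable
  note lim' = lim[folded u0_def]
  { assume "a = a0 \<and> b = b0 \<and> \<nu> = \<nu>0"
    then have [simp]: "a = a0" "b = b0" "\<nu> = \<nu>0" by auto
    have "half_ball_average (\<lambda>z. \<bar>u0 z - b\<bar>) 0 1 \<nu> = half_ball_average (\<lambda>z. 0) 0 1 \<nu>"
      unfolding half_ball_average_def
      by (rule arg_cong2[of _ _ _ _ "(/)"], rule set_lebesgue_integral_cong) (auto simp: half_ball_def u0_def)
    moreover have "half_ball_average (\<lambda>z. \<bar>u0 z - a\<bar>) 0 1 (- \<nu>) = half_ball_average (\<lambda>z. 0) 0 1 (- \<nu>)"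
      unfolding half_ball_average_def
      by (rule arg_cong2[of _ _ _ _ "(/)"], rule set_lebesgue_integral_cong) (auto simp: half_ball_def u0_def)
    ultimately show "jump_triple u x a b \<nu>"
      using half_ball_average_tendsto[OF m u0m bound lim', of b \<nu>]
        half_ball_average_tendsto[OF m u0m bound lim', of a "- \<nu>"] ab \<nu>0
      by (auto simp: jump_triple_def half_ball_average_def) }
  assume jump: "jump_triple u x a b \<nu>"
  then have \<nu>: "norm \<nu> = 1" "a < b" by (auto simp: jump_triple_def)
  have b0: "\<bar>u0 y\<bar> \<le> max M (max \<bar>a0\<bar> \<bar>b0\<bar>)" "\<bar>u y\<bar> \<le> max M (max \<bar>a0\<bar> \<bar>b0\<bar>)" for y
    using bound[of y] by (auto simp: u0_def)
  note blow = jump_triple_blowup[OF m u0m b0(2) b0(1) lim' jump]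
  have upper: "b = b0" if "\<nu> \<noteq> - \<nu>0"
    using open_AE_ex[OF half_ball_point[OF \<nu>(1) \<nu>0 that] blow(1)] by (auto simp: u0_def)
  have upper': "a = b0" if "- \<nu> \<noteq> - \<nu>0"
    using open_AE_ex[OF half_ball_point[of "- \<nu>" \<nu>0] blow(2)] \<nu> \<nu>0 that by (auto simp: u0_def)
  have lower: "b = a0" if "\<nu> \<noteq> \<nu>0"
    using open_AE_ex[OF half_ball_point[of \<nu> "- \<nu>0"] blow(1)] \<nu> \<nu>0 that by (auto simp: u0_def)
  have lower': "a = a0" if "- \<nu> \<noteq> \<nu>0"
    using open_AE_ex[OF half_ball_point[of "- \<nu>" "- \<nu>0"] blow(2)] \<nu> \<nu>0 that by (auto simp: u0_def)
  have eq: "\<nu> = \<nu>0"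
  proof (rule ccontr)
    assume "\<nu> \<noteq> \<nu>0"
    then have "a = b0" "b = a0" using upper' lower by auto
    then show False using \<nu>(2) ab by simp
  qed
  moreover have ne: "\<nu>0 \<noteq> - \<nu>0"
  proof
    assume "\<nu>0 = - \<nu>0"
    then have "\<nu>0 \<bullet> \<nu>0 = - (\<nu>0 \<bullet> \<nu>0)" by (metis inner_minus_left)
    then show False using \<nu>0 by (simp add: dot_square_norm)
  qed
  then have "- \<nu>0 \<noteq> \<nu>0" by (rule not_sym)
  ultimately show "a = a0 \<and> b = b0 \<and> \<nu> = \<nu>0" using upper lower' by metis
qed

lemma not_jump_continuous:
  fixes u :: "'a::euclidean_space \<Rightarrow> real"
  assumes m: "u \<in> borel_measurable borel" and bound: "\<And>y. \<bar>u y\<bar> \<le> M" and cont: "isCont u x"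
  shows "\<not> jump_triple u x a b \<nu>"
proof
  assume jump: "jump_triple u x a b \<nu>"
  have lim: "((\<lambda>r. u (x + r *\<^sub>R z)) \<longlongrightarrow> u x) (at_right 0)" for z
  proof -
    have "((\<lambda>r. x + r *\<^sub>R z) \<longlongrightarrow> x + 0 *\<^sub>R z) (at_right 0)" by (intro tendsto_intros)
    then show ?thesis using isCont_tendsto_compose[OF cont] by simp
  qed
  from jump have \<nu>: "norm \<nu> = 1" "a < b" by (auto simp: jump_triple_def)
  have ne: "half_ball 0 1 \<nu>' \<noteq> {}" if "norm \<nu>' = 1" for \<nu>' :: 'a
    using measure_half_ball_pos[OF that] by (metis less_irrefl measure_empty)
  have bx: "\<bar>u x\<bar> \<le> M" by (rule bound)
  have limAE: "AE z in lborel. ((\<lambda>r. u (x + r *\<^sub>R z)) \<longlongrightarrow> u x) (at_right 0)"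
    using lim by (intro AE_I2)
  have const: "(\<lambda>_::'a. u x) \<in> borel_measurable borel" by simp
  note blow = jump_triple_blowup[OF m const bound bx limAE jump]
  have "u x = b" "u x = a"
    using open_AE_ex[OF open_half_ball ne blow(1)] open_AE_ex[OF open_half_ball ne[of "- \<nu>"] blow(2)] \<nu>(1) by auto
  then show False using \<nu> by simp
qed

section \<open>Surface measure and divergence theorem on balls\<close>

text \<open>The surface measure on the sphere of radius \<open>R\<close>: the area of a piece of the unit sphere is \<open>n\<close> times the
  volume of the cone over it, and area scales with \<open>R ^ (n - 1)\<close>. The centre, which
  \<open>sgn\<close> does not map into the sphere, is a null set.\<close>

definition sphere_measure :: "real \<Rightarrow> 'a::euclidean_space measure" where
  "sphere_measure R = distr
     (density lborel (\<lambda>z. ennreal (real DIM('a) * R ^ (DIM('a) - 1) * indicator (ball 0 1) z)))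
     borel (\<lambda>z. R *\<^sub>R sgn z)"

lemma sgn_borel_measurable[measurable]:
  "(sgn :: 'a::euclidean_space \<Rightarrow> 'a) \<in> borel_measurable borel"
  unfolding sgn_div_norm by measurable

lemma sets_sphere_measure[simp]: "sets (sphere_measure R) = sets borel"
  by (simp add: sphere_measure_def)

lemma integral_sphere_measure:
  fixes f :: "'a::euclidean_space \<Rightarrow> real"
  assumes [measurable]: "f \<in> borel_measurable borel" and "R > 0"
  shows "(LINT x|sphere_measure R. f x) =
    real DIM('a) * R ^ (DIM('a) - 1) * (LINT z|lborel. indicator (ball 0 1) z * f (R *\<^sub>R sgn z))"
proof -
  have "(LINT x|sphere_measure R. f x) =
    (LINT z|lborel. (real DIM('a) * R ^ (DIM('a) - 1) * indicator (ball 0 1) z) *\<^sub>R f (R *\<^sub>R sgn z))"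
    unfolding sphere_measure_def using assms(2)
    by (subst integral_distr, simp, simp, subst integral_density)
      (auto intro!: borel_measurable_times borel_measurable_const borel_measurable_indicator)
  then show ?thesis by (simp add: mult.assoc)
qed

lemma AE_sphere_measure:
  assumes "R > 0"
  shows "AE x in sphere_measure R. norm (x::'a::euclidean_space) = R"
proof -
  have "AE z in lborel. 0 < ennreal (real DIM('a) * R ^ (DIM('a) - 1) * indicator (ball 0 1) z)
      \<longrightarrow> norm (R *\<^sub>R sgn (z::'a)) = R"
    using AE_notin_sphere[of 0]
  proof eventually_elim
    case (elim z)
    then have "norm (R *\<^sub>R sgn z) = R" using assms by (simp add: norm_sgn)
    then show ?case by blast
  qed
  then show ?thesis
    unfolding sphere_measure_def by (subst AE_distr_iff, simp, simp, subst AE_density)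
      (auto intro!: measurable_compose[OF _ measurable_ennreal] borel_measurable_times borel_measurable_const
        borel_measurable_indicator)
qed

lemma finite_sphere_measure: "finite_measure (sphere_measure R :: 'a::euclidean_space measure)"
proof
  have "(\<integral>\<^sup>+z. ennreal (real DIM('a) * R ^ (DIM('a) - 1) * indicator (ball (0::'a) 1) z) \<partial>lborel)
      = (\<integral>\<^sup>+z. ennreal (real DIM('a) * R ^ (DIM('a) - 1)) * indicator (ball (0::'a) 1) z \<partial>lborel)"
    by (intro nn_integral_cong) (auto simp: indicator_def)
  also have "\<dots> = ennreal (real DIM('a) * R ^ (DIM('a) - 1)) * emeasure lborel (ball (0::'a) 1)"
    by (rule nn_integral_cmult_indicator) simp
  also have "\<dots> \<noteq> \<infinity>"
    using emeasure_lborel_ball_finite[of "0::'a" 1] by (simp add: ennreal_mult_eq_top_iff)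
  finally show "emeasure (sphere_measure R) (space (sphere_measure R :: 'a measure)) \<noteq> \<infinity>"
    unfolding sphere_measure_def
    by (subst emeasure_distr, simp, simp, subst emeasure_density)
      (auto intro!: measurable_compose[OF _ measurable_ennreal] borel_measurable_times
        borel_measurable_const borel_measurable_indicator)
qed

lemma norm_directional_derivative:
  fixes z v :: "'a::euclidean_space"
  assumes "z \<noteq> 0"
  shows "((\<lambda>s. norm (z + s *\<^sub>R v)) has_real_derivative sgn z \<bullet> v) (at 0)"
proof -
  have g: "((\<lambda>s::real. z + s *\<^sub>R v) has_derivative (\<lambda>s. s *\<^sub>R v)) (at 0)"
    by (auto intro!: derivative_eq_intros)
  have f: "(norm has_derivative (\<lambda>h. h \<bullet> sgn z)) (at (z + 0 *\<^sub>R v))"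
    using assms by (simp add: has_derivative_norm)
  have "((\<lambda>s. norm (z + s *\<^sub>R v)) has_derivative (\<lambda>s. (s *\<^sub>R v) \<bullet> sgn z)) (at 0)"
    by (rule has_derivative_compose[OF g f])
  moreover have "(\<lambda>s. (s *\<^sub>R v) \<bullet> sgn z) = (*) (sgn z \<bullet> v)"
    by (auto simp: inner_commute)
  ultimately show ?thesis by (simp add: has_field_derivative_def)
qed

lemma radial_directional_derivative:
  fixes z v :: "'a::euclidean_space"
  assumes "(p has_real_derivative d) (at (norm z))" "z \<noteq> 0"
  shows "((\<lambda>s. p (norm (z + s *\<^sub>R v))) has_real_derivative d * (sgn z \<bullet> v)) (at 0)"
  using DERIV_chain2[of p d "\<lambda>s. norm (z + s *\<^sub>R v)" 0] norm_directional_derivative[OF assms(2)] assms(1)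
  by simp

lemma abs_sgn_inner_le: "\<bar>sgn z \<bullet> v\<bar> \<le> norm (v::'a::euclidean_space)"
proof -
  have "\<bar>sgn z \<bullet> v\<bar> \<le> norm (sgn z) * norm v" by (rule Cauchy_Schwarz_ineq2)
  also have "\<dots> \<le> 1 * norm v" by (intro mult_right_mono) (auto simp: norm_sgn)
  finally show ?thesis by simp
qed

text \<open>The integral of a function that is constant along rays over a ball of radius \<open>r\<close> scales with \<open>r ^ n\<close>, and
  the annulus is a difference of two balls.\<close>

lemma integral_annulus_homogeneous:
  fixes g :: "'a::euclidean_space \<Rightarrow> real"
  assumes [measurable]: "g \<in> borel_measurable borel" and bound: "\<And>z. \<bar>g z\<bar> \<le> M"
    and hom: "\<And>c z. c > 0 \<Longrightarrow> g (c *\<^sub>R z) = g z" and R: "0 < R" "R \<le> S"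
  shows "(LINT z|lborel. indicator {z. R \<le> norm z \<and> norm z < S} z * g z) =
    (S ^ DIM('a) - R ^ DIM('a)) * (LINT z|lborel. indicator (ball 0 1) z * g z)"
proof -
  have ball: "(LINT z|lborel. indicator (ball 0 r) z * g z) =
      r ^ DIM('a) * (LINT z|lborel. indicator (ball 0 1) z * g z)" if "r > 0" for r
    using that hom[OF that]
    by (subst integral_lborel_scale[of _ r 0]) (auto simp: indicator_def)
  have int: "integrable lborel (\<lambda>z. indicator (ball 0 r) z * g z)" for r
    using bound by (intro integrable_lborel_bounded_support[of _ r M])
      (auto simp: indicator_def intro: order_trans[OF abs_ge_zero])
  have "(\<lambda>z. indicator {z. R \<le> norm z \<and> norm z < S} z * g z) =
      (\<lambda>z. indicator (ball 0 S) z * g z - indicator (ball 0 R) z * g z)"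
    using R by (auto simp: indicator_def)
  then have "(LINT z|lborel. indicator {z. R \<le> norm z \<and> norm z < S} z * g z) =
      (LINT z|lborel. indicator (ball 0 S) z * g z) - (LINT z|lborel. indicator (ball 0 R) z * g z)"
    by (simp add: int)
  then show ?thesis using ball[of S] ball[of R] R by (simp add: left_diff_distrib)
qed

text \<open>The cutoff that is \<open>1\<close> up to radius \<open>R\<close> and decreases linearly to \<open>0\<close> on a layer of width \<open>e\<close> is
  Lipschitz, and the derivative of its product with \<open>H\<close> has integral zero. Hence the integral of \<open>D\<close>
  against the cutoff is \<open>1/e\<close> times the integral of \<open>H (x/|x| \<bullet> v)\<close> over the layer. Replacing \<open>H\<close> by
  its value at the radial projection changes the integrand by \<open>O(e)\<close> on a layer of volume \<open>O(e)\<close>, and the projected integrand is constant along rays, so its integral over the layer is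
  \<open>((R + e) ^ n - R ^ n)\<close> times its integral over the unit ball.\<close>

theorem divergence_theorem_cball:
  fixes H D :: "'a::euclidean_space \<Rightarrow> real"
  assumes lip: "L-lipschitz_on UNIV H" and R: "R > 0"
    and supp: "\<And>z. z \<notin> cball 0 B \<Longrightarrow> H z = 0"
    and D[measurable]: "D \<in> borel_measurable borel"
    and deriv: "AE z in lborel. ((\<lambda>s. H (z + s *\<^sub>R v)) has_real_derivative D z) (at 0)"
  shows "(LINT z|lborel. indicator (cball 0 R) z * D z) =
    (LINT x|sphere_measure R. H x * (sgn x \<bullet> v))"
proof -
  let ?n = "DIM('a)"
  have L: "\<bar>H x - H y\<bar> \<le> L * norm (x - y)" for x y
    using lipschitz_onD[OF lip, of x y] by (simp add: dist_norm)
  have L0: "0 \<le> L" using lip by (rule lipschitz_on_nonneg)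
  have contH: "continuous_on UNIV H" using lip by (rule lipschitz_on_continuous_on)
  then have [measurable]: "H \<in> borel_measurable borel" by (rule borel_measurable_continuous_onI)
  have "bounded (H ` cball 0 B)"
    by (intro compact_imp_bounded compact_continuous_image continuous_on_subset[OF contH]) auto
  then obtain M0 where M0: "\<And>z. z \<in> cball 0 B \<Longrightarrow> \<bar>H z\<bar> \<le> M0"
    unfolding bounded_iff by (metis image_eqI real_norm_def)
  define M where "M = max M0 0"
  have M: "\<bar>H z\<bar> \<le> M" for z
    using M0[of z] supp[of z] by (cases "z \<in> cball 0 B") (auto simp: M_def)
  have M_ge: "0 \<le> M" by (simp add: M_def)
  have intD: "integrable lborel D"
  proof (rule integral_directional_derivative_eq_0(1)[OF contH supp _ D deriv])
    show "\<bar>H (z + h *\<^sub>R v) - H z\<bar> \<le> (L * norm v) * \<bar>h\<bar>" for z h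
      using L[of "z + h *\<^sub>R v" z] by (simp add: mult_ac)
  qed
  define c where "c e r = max 0 (min 1 (1 - (r - R) / e))" for e r :: real
  define A where "A e = {z::'a. R \<le> norm z \<and> norm z < R + e}" for e
  have A[measurable]: "A e \<in> sets borel" for e
    unfolding A_def by measurable
  define J where "J e = (LINT z|lborel. indicator (A e) z * (H z * (sgn z \<bullet> v)))" for e
  define I where "I = (LINT z|lborel. indicator (ball 0 1) z * (H (R *\<^sub>R sgn z) * (sgn z \<bullet> v)))"
  have c01: "0 \<le> c e r" "c e r \<le> 1" for e r by (auto simp: c_def)
  have clip: "\<bar>c e r - c e s\<bar> \<le> \<bar>r - s\<bar> / e" if "e > 0" for e r s
  proof -
    have "\<bar>c e r - c e s\<bar> \<le> \<bar>(1 - (r - R) / e) - (1 - (s - R) / e)\<bar>"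
      unfolding c_def by linarith
    also have "\<dots> = \<bar>(s - r) / e\<bar>" by (simp add: diff_divide_distrib)
    finally show ?thesis using that by (simp add: abs_minus_commute)
  qed
  have parts: "(LINT z|lborel. c e (norm z) * D z) = J e / e" if e: "e > 0" for e
  proof -
    define G where "G z = c e (norm z) * H z" for z
    define E where "E z = c e (norm z) * D z - indicator (A e) z * (H z * (sgn z \<bullet> v)) / e" for z
    have [measurable]: "c e \<in> borel_measurable borel" unfolding c_def by measurable
    have cc: "continuous_on UNIV G"
      unfolding G_def c_def using e by (intro continuous_intros contH) auto
    have lipG: "\<bar>G (z + h *\<^sub>R v) - G z\<bar> \<le> (L * norm v + M * norm v / e) * \<bar>h\<bar>" for z h
    proof -
      let ?w = "z + h *\<^sub>R v"
      have nd: "\<bar>norm ?w - norm z\<bar> \<le> \<bar>h\<bar> * norm v"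
        using norm_triangle_ineq3[of ?w z] by simp
      have "G ?w - G z = c e (norm ?w) * (H ?w - H z) + H z * (c e (norm ?w) - c e (norm z))"
        by (simp add: G_def algebra_simps)
      also have "\<bar>\<dots>\<bar> \<le> \<bar>c e (norm ?w)\<bar> * \<bar>H ?w - H z\<bar> + \<bar>H z\<bar> * \<bar>c e (norm ?w) - c e (norm z)\<bar>"
        by (rule order_trans[OF abs_triangle_ineq]) (simp add: abs_mult)
      also have "\<dots> \<le> 1 * (L * (\<bar>h\<bar> * norm v)) + M * (\<bar>h\<bar> * norm v / e)"
      proof (intro add_mono mult_mono)
        show "\<bar>H ?w - H z\<bar> \<le> L * (\<bar>h\<bar> * norm v)" using L[of ?w z] by simp
        show "\<bar>c e (norm ?w) - c e (norm z)\<bar> \<le> \<bar>h\<bar> * norm v / e"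
          using clip[OF e, of "norm ?w" "norm z"] nd e by (meson divide_right_mono less_imp_le order_trans)
      qed (use c01 M M_ge e L0 in \<open>auto simp: abs_of_nonneg\<close>)
      also have "\<dots> = (L * norm v + M * norm v / e) * \<bar>h\<bar>" by (simp add: algebra_simps)
      finally show ?thesis .
    qed
    have dG: "AE z in lborel. ((\<lambda>s. G (z + s *\<^sub>R v)) has_real_derivative E z) (at 0)"
      using deriv AE_notin_sphere[of 0] AE_notin_sphere[of R] AE_notin_sphere[of "R + e"]
    proof eventually_elim
      case (elim z)
      have "(c e has_real_derivative (if z \<in> A e then - 1 / e else 0)) (at (norm z))"
      proof (cases "norm z < R")
        case True
        have "(c e has_real_derivative 0) (at (norm z))"
          by (rule has_field_derivative_transform_within_open[of "\<lambda>_. 1" _ _ "{..<R}"])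
            (use True e in \<open>auto simp: c_def divide_simps\<close>)
        then show ?thesis using True by (simp add: A_def)
      next
        case F: False
        show ?thesis
        proof (cases "norm z < R + e")
          case True
          have "((\<lambda>r. 1 - (r - R) / e) has_real_derivative - 1 / e) (at (norm z))"
            using e by (auto intro!: derivative_eq_intros)
          then have "(c e has_real_derivative - 1 / e) (at (norm z))"
            by (rule has_field_derivative_transform_within_open[of _ _ _ "{R<..<R+e}"])
              (use True F elim e in \<open>auto simp: c_def divide_simps\<close>)
          then show ?thesis using True F by (simp add: A_def)
        next
          case False
          have "(c e has_real_derivative 0) (at (norm z))"
            by (rule has_field_derivative_transform_within_open[of "\<lambda>_. 0" _ _ "{R+e<..}"])
              (use False elim e in \<open>auto simp: c_def divide_simps\<close>)
          then show ?thesis using False by (simp add: A_def)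
        qed
      qed
      from radial_directional_derivative[OF this, of v] elim
      have "((\<lambda>s. c e (norm (z + s *\<^sub>R v))) has_real_derivative
        (if z \<in> A e then - 1 / e else 0) * (sgn z \<bullet> v)) (at 0)" by simp
      from DERIV_mult[OF this elim(1)] show ?case
        by (auto simp: G_def E_def indicator_def algebra_simps split: if_splits)
    qed
    have "(LINT z|lborel. E z) = 0"
    proof (rule integral_directional_derivative_eq_0(2)[OF cc _ lipG _ dG])
      show "G z = 0" if "z \<notin> cball 0 B" for z using supp[OF that] by (simp add: G_def)
      show "E \<in> borel_measurable borel" unfolding E_def by measurable
    qed
    moreover have "integrable lborel (\<lambda>z. c e (norm z) * D z)"
    proof (rule Bochner_Integration.integrable_bound[OF intD])
      show "AE z in lborel. norm (c e (norm z) * D z) \<le> norm (D z)"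
        using c01[of e] by (intro AE_I2) (auto simp: abs_mult mult_left_le_one_le)
    qed auto
    moreover have "integrable lborel (\<lambda>z. indicator (A e) z * (H z * (sgn z \<bullet> v)) / e)"
    proof (rule integrable_lborel_bounded_support[of _ "R + e" "M * norm v / e"])
      show "norm (indicator (A e) z * (H z * (sgn z \<bullet> v)) / e) \<le> M * norm v / e" for z
        using mult_mono[OF M[of z] abs_sgn_inner_le[of z v]] M_ge e
        by (auto simp: indicator_def abs_mult divide_right_mono)
    qed (auto simp: A_def indicator_def)
    ultimately show ?thesis unfolding E_def J_def by simp
  qed
  define h where "h i = 1 / real (Suc i)" for i
  have h: "0 < h i" for i by (auto simp: h_def)
  have h0: "h \<longlonglongrightarrow> 0"
    unfolding h_def by (rule LIMSEQ_Suc[OF lim_1_over_n])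
  have fl: "filterlim h (at 0) sequentially"
    using h0 h by (auto simp: filterlim_at intro!: always_eventually) (metis less_irrefl)
  have lhs: "(\<lambda>i. LINT z|lborel. c (h i) (norm z) * D z) \<longlonglongrightarrow>
      (LINT z|lborel. indicator (cball 0 R) z * D z)"
  proof (rule integral_dominated_convergence[where w = "\<lambda>z. norm (D z)"])
    show "integrable lborel (\<lambda>z. norm (D z))" using intD by simp
    show "AE z in lborel. (\<lambda>i. c (h i) (norm z) * D z) \<longlonglongrightarrow> indicator (cball 0 R) z * D z"
    proof (intro AE_I2 tendsto_mult tendsto_const)
      fix z :: 'a
      show "(\<lambda>i. c (h i) (norm z)) \<longlonglongrightarrow> indicator (cball 0 R) z"
      proof (cases "norm z \<le> R")
        case True
        then have "(norm z - R) / h i \<le> 0" for i using h[of i] by (simp add: divide_le_0_iff)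
        then have "c (h i) (norm z) = 1" for i by (simp add: c_def min_def max_def)
        then show ?thesis using True by simp
      next
        case False
        have "\<forall>\<^sub>F i in sequentially. h i < norm z - R"
          using h0 False by (intro order_tendstoD(2)) auto
        then have "\<forall>\<^sub>F i in sequentially. c (h i) (norm z) = 0"
        proof eventually_elim
          case (elim i)
          then have "(norm z - R) / h i \<ge> 1" using h[of i] by simp
          then show ?case by (simp add: c_def)
        qed
        then show ?thesis using False by (simp add: tendsto_eventually)
      qed
    qed
    show "AE z in lborel. norm (c (h i) (norm z) * D z) \<le> norm (D z)" for i
      using c01 by (intro AE_I2) (auto simp: abs_mult mult_left_le_one_le)
    have [measurable]: "c (h i) \<in> borel_measurable borel" for i unfolding c_def by measurable
    show "(\<lambda>z. c (h i) (norm z) * D z) \<in> borel_measurable lborel" for i by measurable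
    show "(\<lambda>z. indicator (cball 0 R) z * D z) \<in> borel_measurable lborel"
      using D by (auto intro!: borel_measurable_times borel_measurable_indicator)
  qed
  have hom: "(LINT z|lborel. indicator (A e) z * (H (R *\<^sub>R sgn z) * (sgn z \<bullet> v))) =
      ((R + e) ^ ?n - R ^ ?n) * I" if "e > 0" for e
    unfolding A_def I_def
  proof (rule integral_annulus_homogeneous[where M = "M * norm v"])
    show "\<bar>H (R *\<^sub>R sgn z) * (sgn z \<bullet> v)\<bar> \<le> M * norm v" for z
      unfolding abs_mult using M abs_sgn_inner_le M_ge by (intro mult_mono) auto
    show "H (R *\<^sub>R sgn (c *\<^sub>R z)) * (sgn (c *\<^sub>R z) \<bullet> v) = H (R *\<^sub>R sgn z) * (sgn z \<bullet> v)" if "c > 0" for c z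
      using that by (simp add: sgn_scaleR)
  qed (use that R in auto)
  have area: "(LINT z|lborel. indicator (A e) z * 1) =
      ((R + e) ^ ?n - R ^ ?n) * (LINT z|lborel. indicator (ball (0::'a) 1) z * 1)" if "e > 0" for e
    unfolding A_def by (rule integral_annulus_homogeneous[where M = 1]) (use that R in auto)
  have diff: "\<bar>J e / e - ((R + e) ^ ?n - R ^ ?n) / e * I\<bar> \<le>
      L * norm v * (((R + e) ^ ?n - R ^ ?n) * (LINT z|lborel. indicator (ball (0::'a) 1) z * 1))"
    if e: "e > 0" for e
  proof -
    let ?f = "\<lambda>z. indicator (A e) z * (H z * (sgn z \<bullet> v))"
    let ?g = "\<lambda>z. indicator (A e) z * (H (R *\<^sub>R sgn z) * (sgn z \<bullet> v))"
    have bd: "\<bar>indicator (A e) z * (H y * (sgn z \<bullet> v))\<bar> \<le> M * norm v" for z y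
      using mult_mono[OF M[of y] abs_sgn_inner_le[of z v]] M_ge by (auto simp: indicator_def abs_mult)
    have int: "integrable lborel ?f" "integrable lborel ?g"
      using bd by (intro integrable_lborel_bounded_support[of _ "R + e" "M * norm v"];
        auto simp: A_def indicator_def)+
    have intA: "integrable lborel (\<lambda>z. e * L * norm v * (indicator (A e) z * 1))"
      by (intro integrable_mult_right integrable_lborel_bounded_support[of _ "R + e" 1])
        (auto simp: A_def indicator_def)
    have "\<bar>J e - ((R + e) ^ ?n - R ^ ?n) * I\<bar> = \<bar>LINT z|lborel. ?f z - ?g z\<bar>"
      unfolding J_def hom[OF e, symmetric] using int by simp
    also have "\<dots> \<le> (LINT z|lborel. \<bar>?f z - ?g z\<bar>)"
      by (rule integral_abs_bound)
    also have "\<dots> \<le> (LINT z|lborel. e * L * norm v * (indicator (A e) z * 1))"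
    proof (rule integral_mono[OF _ intA])
      show "integrable lborel (\<lambda>z. \<bar>?f z - ?g z\<bar>)" using int by (intro integrable_abs) simp
      fix z :: 'a
      show "\<bar>?f z - ?g z\<bar> \<le> e * L * norm v * (indicator (A e) z * 1)"
      proof (cases "z \<in> A e")
        case True
        then have z: "R \<le> norm z" "norm z < R + e" "z \<noteq> 0" using R by (auto simp: A_def)
        have "z - R *\<^sub>R sgn z = (norm z - R) *\<^sub>R sgn z"
          using z by (simp add: sgn_div_norm left_diff_distrib scaleR_diff_left)
        then have "norm (z - R *\<^sub>R sgn z) \<le> e" using z by (simp add: norm_sgn)
        then have "\<bar>H z - H (R *\<^sub>R sgn z)\<bar> \<le> L * e"
          using L[of z "R *\<^sub>R sgn z"] L0 by (meson mult_left_mono order_trans)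
        then have "\<bar>H z - H (R *\<^sub>R sgn z)\<bar> * \<bar>sgn z \<bullet> v\<bar> \<le> L * e * norm v"
          using abs_sgn_inner_le[of z v] L0 e by (intro mult_mono) auto
        moreover have "?f z - ?g z = (H z - H (R *\<^sub>R sgn z)) * (sgn z \<bullet> v)"
          using True by (simp add: algebra_simps)
        ultimately show ?thesis using True by (simp add: abs_mult mult_ac)
      qed simp
    qed
    also have "\<dots> = e * (L * norm v * (((R + e) ^ ?n - R ^ ?n) * (LINT z|lborel. indicator (ball (0::'a) 1) z * 1)))"
      by (simp only: integral_mult_right_zero area[OF e] mult.assoc)
    finally have *: "\<bar>J e - ((R + e) ^ ?n - R ^ ?n) * I\<bar> \<le>
      e * (L * norm v * (((R + e) ^ ?n - R ^ ?n) * (LINT z|lborel. indicator (ball (0::'a) 1) z * 1)))" .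
    have "J e / e - ((R + e) ^ ?n - R ^ ?n) / e * I = (J e - ((R + e) ^ ?n - R ^ ?n) * I) / e"
      by (simp only: diff_divide_distrib[of "J e"] times_divide_eq_left)
    then have eq: "\<bar>J e / e - ((R + e) ^ ?n - R ^ ?n) / e * I\<bar> = \<bar>J e - ((R + e) ^ ?n - R ^ ?n) * I\<bar> / e"
      using e by (simp only: abs_divide abs_of_pos)
    show ?thesis unfolding eq pos_divide_le_eq[OF e] using * by (simp only: mult.commute[of e])
  qed
  have quot: "(\<lambda>i. ((R + h i) ^ ?n - R ^ ?n) / h i) \<longlonglongrightarrow> real ?n * R ^ (?n - 1)"
  proof -
    have "((\<lambda>r. r ^ ?n) has_real_derivative real ?n * R ^ (?n - 1)) (at R)"
      by (auto intro!: derivative_eq_intros)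
    then have "((\<lambda>e. ((R + e) ^ ?n - R ^ ?n) / e) \<longlongrightarrow> real ?n * R ^ (?n - 1)) (at 0)"
      by (simp add: DERIV_def)
    then show ?thesis by (rule filterlim_compose[OF _ fl])
  qed
  define a where "a = (LINT z|lborel. indicator (ball (0::'a) 1) z * (1::real))"
  have "(\<lambda>i. L * norm v * (((R + h i) ^ ?n - R ^ ?n) * a)) \<longlonglongrightarrow> L * norm v * (((R + 0) ^ ?n - R ^ ?n) * a)"
    by (intro tendsto_intros h0)
  then have lim0: "(\<lambda>i. L * norm v * (((R + h i) ^ ?n - R ^ ?n) * a)) \<longlonglongrightarrow> 0"
    by simp
  have "(\<lambda>i. J (h i) / h i - ((R + h i) ^ ?n - R ^ ?n) / h i * I) \<longlonglongrightarrow> 0"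
  proof (rule Lim_null_comparison[OF always_eventually lim0], rule allI)
    show "norm (J (h i) / h i - ((R + h i) ^ ?n - R ^ ?n) / h i * I) \<le>
        L * norm v * (((R + h i) ^ ?n - R ^ ?n) * a)" for i
      unfolding a_def real_norm_def by (rule diff[OF h])
  qed
  from tendsto_add[OF this tendsto_mult[OF quot tendsto_const[of I]]]
  have "(\<lambda>i. J (h i) / h i) \<longlonglongrightarrow> real ?n * R ^ (?n - 1) * I" by (simp only: diff_add_cancel add_0)
  then have "(\<lambda>i. LINT z|lborel. c (h i) (norm z) * D z) \<longlonglongrightarrow> real ?n * R ^ (?n - 1) * I"
    by (simp only: parts[OF h])
  with lhs have "(LINT z|lborel. indicator (cball 0 R) z * D z) = real ?n * R ^ (?n - 1) * I"
    by (rule LIMSEQ_unique)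
  also have "\<dots> = (LINT x|sphere_measure R. H x * (sgn x \<bullet> v))"
  proof -
    have "sgn (R *\<^sub>R sgn z) = sgn z" for z :: 'a
      using R by (simp add: sgn_scaleR sgn_div_norm[of "sgn z"] norm_sgn)
    then show ?thesis unfolding I_def using R by (subst integral_sphere_measure) auto
  qed
  finally show ?thesis .
qed

section \<open>Conditions that hold at every point\<close>

text \<open>The conditions that are required up to a Hausdorff null set are verified below at every point. For
  \<open>n = 1\<close> this is unavoidable, since the zero-dimensional measure has no nonempty null sets.\<close>

lemma hausdorff_aeI:
  assumes "\<And>x. x \<in> A \<Longrightarrow> P x"
  shows "hausdorff_ae k A P"
proof -
  have "{x\<in>A. \<not> P x} = {}" using assms by auto
  moreover have "hausdorff_measure k {} = (0::ennreal)"
    unfolding hausdorff_measure_def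
  proof (intro antisym SUP_least)
    fix d :: real assume "d \<in> {0<..}"
    then show "(INF C\<in>{C. {} \<subseteq> (\<Union>i. C i) \<and> (\<forall>i. bounded (C i) \<and> diameter (C i) \<le> d)}.
        \<Sum>i. hausdorff_weight k (C i)) \<le> 0"
      by (intro INF_lower2[of "\<lambda>_. {}"]) (auto simp: hausdorff_weight_def)
  qed simp
  ultimately show ?thesis unfolding hausdorff_ae_def by (simp only:)
qed

lemma continuous_on_approximately_regular:
  fixes \<phi> :: "'a::euclidean_space \<Rightarrow> 'a"
  assumes "continuous_on D \<phi>"
  shows "approximately_regular D \<phi>"
  unfolding approximately_regular_def
proof (intro allI impI hausdorff_aeI)
  fix S z0 \<nu> and \<epsilon> :: real
  assume z0: "z0 \<in> S \<inter> D" and \<nu>: "unit_normal_at S z0 \<nu>" and \<epsilon>: "\<epsilon> > 0"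
  then obtain d where d: "d > 0" "\<And>z. z \<in> D \<Longrightarrow> dist z z0 < d \<Longrightarrow> dist (\<phi> z) (\<phi> z0) < \<epsilon>"
    using assms unfolding continuous_on_iff by blast
  let ?E = "{z \<in> D. \<bar>(\<phi> z - \<phi> z0) \<bullet> \<nu>\<bar> > \<epsilon>}"
  have "?E \<inter> ball z0 \<rho> = {}" if "\<rho> < d" for \<rho>
  proof -
    have "\<bar>(\<phi> z - \<phi> z0) \<bullet> \<nu>\<bar> < \<epsilon>" if "z \<in> D" "z \<in> ball z0 \<rho>" for z
    proof -
      have "\<bar>(\<phi> z - \<phi> z0) \<bullet> \<nu>\<bar> \<le> norm (\<phi> z - \<phi> z0)"
        using Cauchy_Schwarz_ineq2[of "\<phi> z - \<phi> z0" \<nu>] \<nu> by (simp add: unit_normal_at_def)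
      also have "\<dots> < \<epsilon>"
        using d(2)[of z] that \<open>\<rho> < d\<close> by (auto simp: dist_norm norm_minus_commute)
      finally show ?thesis .
    qed
    then show ?thesis by force
  qed
  then have "\<forall>\<^sub>F \<rho> in at_right 0. measure lebesgue (?E \<inter> ball z0 \<rho>) / measure lebesgue (ball z0 \<rho>) = 0"
    using d(1) by (auto simp: eventually_at_right_field)
  then show "density_zero_at ?E z0"
    unfolding density_zero_at_def by (rule tendsto_eventually)
qed

section \<open>Divergence-free radial fields\<close>

text \<open>The square makes the positive part continuously differentiable, which is why the potential of the
  truncated field has no kink.\<close>

lemma has_derivative_square_pos_part:
  "((\<lambda>y::real. (max 0 y)\<^sup>2) has_real_derivative 2 * max 0 y) (at y)"
proof (cases y "0::real" rule: linorder_cases)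
  case less
  have "((\<lambda>y::real. (max 0 y)\<^sup>2) has_real_derivative 0) (at y)"
    by (rule has_field_derivative_transform_within_open[of "\<lambda>_. 0" _ _ "{..<0}"]) (use less in auto)
  then show ?thesis using less by simp
next
  case equal
  have "((\<lambda>h::real. max 0 h) \<longlongrightarrow> max 0 0) (at 0)" by (intro tendsto_intros)
  moreover have "\<forall>\<^sub>F h::real in at 0. max 0 h = ((max 0 (0 + h))\<^sup>2 - (max 0 0)\<^sup>2) / h"
    by (auto simp: eventually_at_filter max_def power2_eq_square)
  ultimately have "((\<lambda>h::real. ((max 0 (0 + h))\<^sup>2 - (max 0 0)\<^sup>2) / h) \<longlongrightarrow> 0) (at 0)"
    by (auto intro: Lim_transform_eventually)
  then show ?thesis using equal by (simp add: DERIV_def)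
next
  case greater
  have "((\<lambda>y::real. y\<^sup>2) has_real_derivative 2 * y) (at y)" by (auto intro!: derivative_eq_intros)
  then have "((\<lambda>y::real. (max 0 y)\<^sup>2) has_real_derivative 2 * y) (at y)"
    by (rule has_field_derivative_transform_within_open[of _ _ _ "{0<..}"]) (use greater in auto)
  then show ?thesis using greater by simp
qed

lemma DERIV_square_pos_part[derivative_intros]:
  assumes "(f has_real_derivative f') (at x within S)"
  shows "((\<lambda>x. (max 0 (f x))\<^sup>2) has_real_derivative 2 * max 0 (f x) * f') (at x within S)"
  using DERIV_chain2[OF has_derivative_square_pos_part assms] .

text \<open>The height at which the horizontal component of the field saturates. Above it the component is
  proportional to \<open>x / |x| ^ (m + 1)\<close>, the gradient of the fundamental solution, hence divergence-free.\<close>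

definition flux_cap :: "real \<Rightarrow> nat \<Rightarrow> real \<Rightarrow> real" where
  "flux_cap K m r = K / r ^ m"

text \<open>The integral of \<open>2 min(s, flux_cap)\<close> over \<open>s\<close> from \<open>0\<close> to \<open>t\<close>, in a form whose regularity
  across the cap is visible; \<open>t\<close> and the cap are thought of as nonnegative.\<close>

definition flux_integral :: "real \<Rightarrow> nat \<Rightarrow> real \<Rightarrow> real \<Rightarrow> real" where
  "flux_integral K m r t = t\<^sup>2 - (max 0 (t - flux_cap K m r))\<^sup>2"

definition flux_potential :: "real \<Rightarrow> real \<Rightarrow> nat \<Rightarrow> 'a \<times> real \<Rightarrow> 'a::euclidean_space" where
  "flux_potential \<beta> K m z = - (\<beta> * flux_integral K m (norm (fst z)) (snd z)) *\<^sub>R sgn (fst z)"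

definition radial_field ::
    "real \<Rightarrow> real \<Rightarrow> nat \<Rightarrow> (real \<Rightarrow> real) \<Rightarrow> 'a \<times> real \<Rightarrow> 'a::euclidean_space \<times> real" where
  "radial_field \<beta> K m e z =
     (- (2 * \<beta> * min (snd z) (flux_cap K m (norm (fst z)))) *\<^sub>R sgn (fst z),
      \<beta> * real m * (min (snd z) (flux_cap K m (norm (fst z))))\<^sup>2 / norm (fst z) + e (norm (fst z)))"

lemma flux_integral_deriv_t:
  "(flux_integral K m r has_real_derivative 2 * min t (flux_cap K m r)) (at t)"
proof -
  have "((\<lambda>t. t\<^sup>2 - (max 0 (t - flux_cap K m r))\<^sup>2) has_real_derivative
      2 * t - 2 * max 0 (t - flux_cap K m r) * 1) (at t)"
    by (auto intro!: derivative_eq_intros)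
  moreover have "2 * t - 2 * max 0 (t - flux_cap K m r) * 1 = 2 * min t (flux_cap K m r)"
    by (auto simp: max_def min_def)
  moreover have "flux_integral K m r = (\<lambda>t. t\<^sup>2 - (max 0 (t - flux_cap K m r))\<^sup>2)"
    by (simp add: flux_integral_def fun_eq_iff)
  ultimately show ?thesis by metis
qed

lemma flux_cap_deriv:
  assumes "r > 0"
  shows "(flux_cap K m has_real_derivative - real m * flux_cap K m r / r) (at r)"
proof (cases m)
  case 0
  then show ?thesis by (auto simp: flux_cap_def[abs_def])
next
  case (Suc k)
  have "((\<lambda>r. K / r ^ Suc k) has_real_derivative
      (0 * r ^ Suc k - K * (real (Suc k) * r ^ k)) / (r ^ Suc k * r ^ Suc k)) (at r)"
    using DERIV_pow[of "Suc k" r] assms by (intro DERIV_divide DERIV_const) auto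
  moreover have "(0 * r ^ Suc k - K * (real (Suc k) * r ^ k)) / (r ^ Suc k * r ^ Suc k) =
      - real (Suc k) * (K / r ^ Suc k) / r"
    using assms by (simp add: divide_simps) (simp add: algebra_simps)
  ultimately show ?thesis unfolding flux_cap_def[abs_def] Suc by metis
qed

lemma flux_integral_deriv_r:
  assumes "r > 0"
  shows "((\<lambda>r. flux_integral K m r t) has_real_derivative
    - 2 * max 0 (t - flux_cap K m r) * (real m * flux_cap K m r / r)) (at r)"
  unfolding flux_integral_def
  by (auto intro!: derivative_eq_intros flux_cap_deriv[OF assms])

text \<open>The left side is the divergence of \<open>x/|x|\<close> times \<open>flux_integral\<close> in dimension \<open>m + 1\<close>.\<close>

lemma flux_integral_radial_divergence:
  assumes "r > 0"
  shows "- 2 * max 0 (t - flux_cap K m r) * (real m * flux_cap K m r / r) + real m * flux_integral K m r t / r =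
    real m * (min t (flux_cap K m r))\<^sup>2 / r"
proof -
  let ?k = "flux_cap K m r"
  have "- 2 * max 0 (t - ?k) * ?k + (t\<^sup>2 - (max 0 (t - ?k))\<^sup>2) = (min t ?k)\<^sup>2"
    by (cases "t \<le> ?k") (auto simp: min_def max_def power2_eq_square algebra_simps)
  moreover have "- 2 * M * (real m * k / r) + real m * (t\<^sup>2 - M\<^sup>2) / r =
      real m * (- 2 * M * k + (t\<^sup>2 - M\<^sup>2)) / r" for M k
    by (simp add: divide_inverse algebra_simps)
  ultimately show ?thesis unfolding flux_integral_def by simp
qed

lemma flux_integral_bounds:
  assumes "0 \<le> t" "0 \<le> flux_cap K m r"
  shows "0 \<le> flux_integral K m r t" "flux_integral K m r t \<le> t\<^sup>2"
  using assms power_mono[of "max 0 (t - flux_cap K m r)" t 2] by (auto simp: flux_integral_def)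

text \<open>The potential is a primitive of the horizontal component in the variable \<open>t\<close>.\<close>

lemma interval_integral_radial_field:
  fixes x :: "'a::euclidean_space"
  shows "(LBINT t=ereal r..ereal s. fst (radial_field \<beta> K m e (x, t))) =
    flux_potential \<beta> K m (x, s) - flux_potential \<beta> K m (x, r)"
proof (rule interval_integral_FTC_finite)
  show "continuous_on {min r s..max r s} (\<lambda>t. fst (radial_field \<beta> K m e (x, t)))"
    unfolding radial_field_def by (auto intro!: continuous_intros)
  fix t
  have "((\<lambda>t. - (\<beta> * flux_integral K m (norm x) t)) has_real_derivative
      - (2 * \<beta> * min t (flux_cap K m (norm x)))) (at t)"
    by (auto intro!: derivative_eq_intros flux_integral_deriv_t)
  then have "((\<lambda>t. - (\<beta> * flux_integral K m (norm x) t) *\<^sub>R sgn x) has_vector_derivative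
      - (2 * \<beta> * min t (flux_cap K m (norm x))) *\<^sub>R sgn x) (at t)"
    using has_vector_derivative_scaleR[OF _ has_vector_derivative_const[of "sgn x"]] by (simp only: scaleR_zero_right add_0)
  then show "((\<lambda>t. flux_potential \<beta> K m (x, t)) has_vector_derivative fst (radial_field \<beta> K m e (x, t)))
      (at t within {min r s..max r s})"
    by (simp add: flux_potential_def radial_field_def has_vector_derivative_at_within)
qed

lemma radial_field_continuous_on:
  assumes "\<And>z. z \<in> A \<Longrightarrow> fst z \<noteq> 0" "continuous_on ((\<lambda>z. norm (fst z)) ` A) e"
  shows "continuous_on A (radial_field \<beta> K m e)"
proof -
  have "continuous_on A (\<lambda>z. e (norm (fst z)))"
    by (rule continuous_on_compose2[OF assms(2)]) (auto intro!: continuous_intros)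
  then show ?thesis
    unfolding radial_field_def flux_cap_def using assms(1) by (auto intro!: continuous_intros)
qed

lemma linear_prod_expand:
  fixes f :: "'a::euclidean_space \<times> real \<Rightarrow> real"
  assumes "linear f"
  shows "f (y, s) = (\<Sum>i\<in>Basis. (y \<bullet> i) * f (i, 0)) + s * f (0, 1)"
proof -
  have "(y, s) = (\<Sum>i\<in>Basis. (y \<bullet> i) *\<^sub>R (i, 0)) + s *\<^sub>R (0, 1)"
    by (simp add: prod_eq_iff fst_sum snd_sum euclidean_representation)
  then have "f (y, s) = f ((\<Sum>i\<in>Basis. (y \<bullet> i) *\<^sub>R (i, 0)) + s *\<^sub>R (0, 1))"
    by (rule arg_cong)
  also have "\<dots> = (\<Sum>i\<in>Basis. (y \<bullet> i) * f (i, 0)) + s * f (0, 1)"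
    unfolding linear_add[OF assms] linear_sum[OF assms] linear_scale[OF assms] by simp
  finally show ?thesis .
qed

text \<open>With \<open>V\<close> the potential, the field is \<open>(\<partial>\<^sub>t V, - div V + e)\<close>. For each coordinate \<open>i\<close>, the terms
  \<open>\<partial>\<^sub>t V\<^sub>i \<partial>\<^sub>i \<psi>\<close> and \<open>\<partial>\<^sub>i V\<^sub>i \<partial>\<^sub>t \<psi>\<close> have the same integral, since both become a mixed second derivative
  of \<open>\<psi>\<close> against \<open>- V\<^sub>i\<close>; and \<open>e\<close> does not depend on \<open>t\<close>.\<close>

theorem radial_field_weakly_divergence_free:
  assumes m: "DIM('a::euclidean_space) = Suc m" and e: "continuous_on {0<..} e"
    and U: "\<And>z. z \<in> U \<Longrightarrow> fst z \<noteq> 0"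
  shows "weakly_divergence_free U (radial_field \<beta> K m e :: 'a \<times> real \<Rightarrow> 'a \<times> real)"
  unfolding weakly_divergence_free_def
proof (intro allI impI)
  fix \<psi> :: "'a \<times> real \<Rightarrow> real"
  assume test: "test_function U \<psi>"
  define C where "C = closure {z. \<psi> z \<noteq> 0}"
  define U0 :: "('a \<times> real) set" where "U0 = {z. fst z \<noteq> 0}"
  have C: "compact C" "C \<subseteq> U0" "C \<subseteq> U"
    using test U by (auto simp: test_function_def C_def U0_def)
  have U0: "open U0"
    unfolding U0_def by (intro open_Collect_neq continuous_intros)
  define d where "d v z = frechet_derivative \<psi> (at z) v" for v z
  define dd where "dd v w z = frechet_derivative (d v) (at z) w" for v w z
  note td = test_functionD[OF test]
  have d_supp: "d v z = 0" if "z \<notin> C" for v z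
    using td(9)[of z v] that unfolding C_def d_def by blast
  have d_cont: "continuous_on UNIV (d v)" for v using td(5) by (simp add: d_def[abs_def])
  have d_deriv: "((\<lambda>s. d v (z + s *\<^sub>R w)) has_real_derivative dd v w z) (at 0)" for v w z
    unfolding dd_def by (rule has_directional_derivative) (use td(7) in \<open>simp add: d_def[abs_def]\<close>)
  have dd_cont: "continuous_on UNIV (dd v w)" for v w
    using td(3)[of "Suc 0" v] by (simp add: d_def[abs_def] dd_def[abs_def] del: split_paired_All)
  have dd_commute: "dd v w = dd w v" for v w
    unfolding dd_def d_def using test_function_mixed_derivatives_commute[OF test] by (auto simp: fun_eq_iff)
  define V where "V i z = flux_potential \<beta> K m z \<bullet> i" for i and z :: "'a \<times> real"
  define Vt where "Vt i z = fst (radial_field \<beta> K m e z) \<bullet> i" for i and z :: "'a \<times> real"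
  define P where "P z = flux_integral K m (norm (fst z)) (snd z)" for z :: "'a \<times> real"
  define P' where "P' z = - 2 * max 0 (snd z - flux_cap K m (norm (fst z))) *
      (real m * flux_cap K m (norm (fst z)) / norm (fst z))" for z :: "'a \<times> real"
  \<comment> \<open>\<open>Q\<close> is the radial derivative of \<open>P / r\<close>, and \<open>V i = - \<beta> (P / r) (x \<bullet> i)\<close>.\<close>
  define Q where "Q z = (P' z * norm (fst z) - P z) / (norm (fst z))\<^sup>2" for z
  define Vx where "Vx i z = - \<beta> * (Q z * (sgn (fst z) \<bullet> i) * (fst z \<bullet> i) + P z / norm (fst z) * (i \<bullet> i))" for i and z :: "'a \<times> real"
  have cV: "continuous_on U0 (V i)" and cVt: "continuous_on U0 (Vt i)" and cVx: "continuous_on U0 (Vx i)" for i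
    unfolding V_def Vt_def Vx_def Q_def P_def P'_def flux_potential_def radial_field_def flux_integral_def flux_cap_def U0_def fst_conv
    by (intro continuous_intros; simp)+
  have V_t: "((\<lambda>s. V i (z + s *\<^sub>R (0, 1))) has_real_derivative Vt i z) (at 0)" if "z \<in> U0" for i z
  proof -
    have "((\<lambda>s. flux_integral K m (norm (fst z)) (snd z + s)) has_real_derivative
        2 * min (snd z) (flux_cap K m (norm (fst z)))) (at 0)"
      using DERIV_shift[of "flux_integral K m (norm (fst z))" _ 0 "snd z"]
        flux_integral_deriv_t[of K m "norm (fst z)" "snd z"] by (simp add: add.commute)
    then have "((\<lambda>s. - (\<beta> * flux_integral K m (norm (fst z)) (snd z + s)) * (sgn (fst z) \<bullet> i)) has_real_derivative
        - (2 * \<beta> * min (snd z) (flux_cap K m (norm (fst z)))) * (sgn (fst z) \<bullet> i)) (at 0)"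
      by (auto intro!: derivative_eq_intros)
    then show ?thesis by (simp add: V_def Vt_def flux_potential_def radial_field_def)
  qed
  have V_x: "((\<lambda>s. V i (z + s *\<^sub>R (i, 0))) has_real_derivative Vx i z) (at 0)" if z: "z \<in> U0" for i z
  proof -
    let ?x = "fst z"
    have x: "?x \<noteq> 0" "norm ?x > 0" using z by (auto simp: U0_def)
    have "((\<lambda>r. flux_integral K m r (snd z) / r) has_real_derivative Q z) (at (norm ?x))"
      using x by (auto intro!: derivative_eq_intros flux_integral_deriv_r
          simp: Q_def P_def P'_def power2_eq_square)
    from radial_directional_derivative[OF this x(1), of i]
    have 1: "((\<lambda>s. flux_integral K m (norm (?x + s *\<^sub>R i)) (snd z) / norm (?x + s *\<^sub>R i)) has_real_derivative
        Q z * (sgn ?x \<bullet> i)) (at 0)" .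
    have 2: "((\<lambda>s. (?x + s *\<^sub>R i) \<bullet> i) has_real_derivative i \<bullet> i) (at 0)"
      unfolding inner_add_left inner_scaleR_left by (auto intro!: derivative_eq_intros)
    have "((\<lambda>s. - \<beta> * (flux_integral K m (norm (?x + s *\<^sub>R i)) (snd z) / norm (?x + s *\<^sub>R i) *
        ((?x + s *\<^sub>R i) \<bullet> i))) has_real_derivative Vx i z) (at 0)"
      using DERIV_cmult[OF DERIV_mult[OF 1 2], of "- \<beta>"]
      by (simp add: Vx_def P_def algebra_simps)
    moreover have "V i (z + s *\<^sub>R (i, 0)) = - \<beta> * (flux_integral K m (norm (?x + s *\<^sub>R i)) (snd z) / norm (?x + s *\<^sub>R i) *
        ((?x + s *\<^sub>R i) \<bullet> i))" for s
      unfolding V_def flux_potential_def by (simp add: sgn_div_norm divide_inverse)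
    ultimately show ?thesis by simp
  qed
  have Vx_sum: "(\<Sum>i\<in>Basis. Vx i z) = - (\<beta> * real m * (min (snd z) (flux_cap K m (norm (fst z))))\<^sup>2 / norm (fst z))"
    if z: "z \<in> U0" for z
  proof -
    let ?x = "fst z"
    have x: "norm ?x > 0" using z by (auto simp: U0_def)
    have "(\<Sum>i\<in>Basis. Vx i z) = - \<beta> * (Q z * (\<Sum>i\<in>Basis. (sgn ?x \<bullet> i) * (?x \<bullet> i)) + P z / norm ?x * (\<Sum>i\<in>(Basis::'a set). i \<bullet> i))"
      by (simp only: Vx_def sum_distrib_left sum.distrib mult.assoc distrib_left)
    also have "(\<Sum>i\<in>Basis. (sgn ?x \<bullet> i) * (?x \<bullet> i)) = norm ?x"
      unfolding euclidean_inner[symmetric] using x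
      by (simp add: sgn_div_norm dot_square_norm power2_eq_square)
    also have "(\<Sum>i\<in>(Basis::'a set). i \<bullet> i) = real m + 1"
      using m by simp
    also have "Q z * norm ?x + P z / norm ?x * (real m + 1) = P' z + real m * P z / norm ?x"
      using x unfolding Q_def by (simp add: divide_simps power2_eq_square) (simp add: algebra_simps)
    also have "\<dots> = real m * (min (snd z) (flux_cap K m (norm ?x)))\<^sup>2 / norm ?x"
      unfolding P_def P'_def by (rule flux_integral_radial_divergence[OF x])
    finally show ?thesis by simp
  qed
  note ibp = integration_by_parts_direction[OF U0 C(1,2)]
  have t: "integrable lborel (\<lambda>z. Vt i z * d (i, 0) z)" for i
    by (rule ibp(1)[OF cV cVt V_t d_cont dd_cont d_deriv d_supp])
  have t': "(LINT z|lborel. Vt i z * d (i, 0) z) = - (LINT z|lborel. V i z * dd (i, 0) (0, 1) z)" for i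
    by (rule ibp(3)[OF cV cVt V_t d_cont dd_cont d_deriv d_supp])
  have x: "integrable lborel (\<lambda>z. Vx i z * d (0, 1) z)" for i
    by (rule ibp(1)[OF cV cVx V_x d_cont dd_cont d_deriv d_supp])
  have x': "(LINT z|lborel. Vx i z * d (0, 1) z) = - (LINT z|lborel. V i z * dd (0, 1) (i, 0) z)" for i
    by (rule ibp(3)[OF cV cVx V_x d_cont dd_cont d_deriv d_supp])
  have ce: "continuous_on U0 (\<lambda>z. e (norm (fst z)))"
    by (rule continuous_on_compose2[OF e]) (auto intro!: continuous_intros simp: U0_def)
  have e_t: "((\<lambda>s. e (norm (fst (z + s *\<^sub>R (0, 1))))) has_real_derivative 0) (at 0)" for z :: "'a \<times> real"
    by simp
  have \<psi>_t: "((\<lambda>s. \<psi> (z + s *\<^sub>R (0, 1))) has_real_derivative d (0, 1) z) (at 0)" for z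
    unfolding d_def by (rule td(6))
  have \<psi>_supp: "\<psi> z = 0" if "z \<notin> C" for z
    using td(8)[of z] that unfolding C_def by blast
  note ibp_e = ibp[OF ce continuous_on_const e_t td(4) d_cont \<psi>_t \<psi>_supp]
  have e0: "integrable lborel (\<lambda>z. e (norm (fst z)) * d (0, 1) z)"
    by (rule ibp_e(2))
  have e0': "(LINT z|lborel. 0 * \<psi> z) = - (LINT z|lborel. e (norm (fst z)) * d (0, 1) z)"
    by (rule ibp_e(3))
  have pointwise: "indicator U z *\<^sub>R frechet_derivative \<psi> (at z) (radial_field \<beta> K m e z) =
      (\<Sum>i\<in>Basis. Vt i z * d (i, 0) z) - (\<Sum>i\<in>Basis. Vx i z * d (0, 1) z) + e (norm (fst z)) * d (0, 1) z" for z
  proof (cases "z \<in> C")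
    case True
    then have z: "z \<in> U0" "z \<in> U" using C by auto
    have "frechet_derivative \<psi> (at z) (radial_field \<beta> K m e z) =
      (\<Sum>i\<in>Basis. Vt i z * d (i, 0) z) + snd (radial_field \<beta> K m e z) * d (0, 1) z"
      using linear_prod_expand[OF linear_frechet_derivative[OF td(2)],
          of z "fst (radial_field \<beta> K m e z)" "snd (radial_field \<beta> K m e z)"]
      by (simp add: Vt_def d_def)
    also have "snd (radial_field \<beta> K m e z) = - (\<Sum>i\<in>Basis. Vx i z) + e (norm (fst z))"
      unfolding Vx_sum[OF z(1)] by (simp add: radial_field_def)
    finally have "frechet_derivative \<psi> (at z) (radial_field \<beta> K m e z) =
      (\<Sum>i\<in>Basis. Vt i z * d (i, 0) z) + (- (\<Sum>i\<in>Basis. Vx i z) + e (norm (fst z))) * d (0, 1) z" .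
    moreover have "(\<Sum>i\<in>Basis. Vx i z * d (0, 1) z) = (\<Sum>i\<in>Basis. Vx i z) * d (0, 1) z"
      by (simp only: sum_distrib_right)
    ultimately show ?thesis using z by (simp add: distrib_right left_diff_distrib)
  next
    case False
    then have "\<psi> differentiable (at z)" "frechet_derivative \<psi> (at z) v = 0" for v
      using td(2) d_supp by (auto simp: d_def)
    then show ?thesis using d_supp[OF False] by simp
  qed
  have "(LINT z:U|lborel. frechet_derivative \<psi> (at z) (radial_field \<beta> K m e z)) =
      (\<Sum>i\<in>Basis. LINT z|lborel. Vt i z * d (i, 0) z) - (\<Sum>i\<in>Basis. LINT z|lborel. Vx i z * d (0, 1) z)
      + (LINT z|lborel. e (norm (fst z)) * d (0, 1) z)"
    unfolding set_lebesgue_integral_def pointwise using t x e0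
    by (simp add: integral_sum)
  also have "\<dots> = 0"
    using e0' by (simp add: t' x' dd_commute[of "(0, 1)"])
  finally show "(LINT z:U|lborel. frechet_derivative \<psi> (at z) (radial_field \<beta> K m e z)) = 0" .
qed

section \<open>The unit sphere as a Lipschitz boundary\<close>

text \<open>Near the boundary point \<open>e\<close> the ball is the region below the graph of \<open>sqrt (1 - |y|\<^sup>2)\<close> over the hyperplane
  orthogonal to \<open>e\<close>. Truncating \<open>|y|\<close> at \<open>1/2\<close> keeps the square root away from its singularity and makes
  the function globally Lipschitz.\<close>

lemma lipschitz_boundary_unit_ball: "lipschitz_boundary (ball (0::'a::euclidean_space) 1)"
  unfolding lipschitz_boundary_def
proof
  fix e :: 'a assume "e \<in> frontier (ball 0 1)"
  then have e: "norm e = 1" by simp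
  then have ee: "e \<bullet> e = 1" by (simp add: dot_square_norm)
  define U where "U = {w. w \<bullet> e > 0 \<and> norm (w - (w \<bullet> e) *\<^sub>R e) < 1 / 2}"
  define f where "f y = sqrt (1 - (min (norm y) (1 / 2))\<^sup>2)" for y :: 'a
  have U: "open U"
    unfolding U_def by (intro open_Collect_conj open_Collect_less continuous_intros)
  have eU: "e \<in> U" by (simp add: U_def ee)
  have lip: "1-lipschitz_on {y. y \<bullet> e = 0} f"
  proof (rule lipschitz_onI)
    fix x y :: 'a
    define a b where "a = min (norm x) (1 / 2)" and "b = min (norm y) (1 / 2)"
    have ab: "0 \<le> a" "a \<le> 1/2" "0 \<le> b" "b \<le> 1/2" by (auto simp: a_def b_def)
    have sq: "a\<^sup>2 \<le> 1/4" "b\<^sup>2 \<le> 1/4"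
      using power_mono[of a "1/2" 2] power_mono[of b "1/2" 2] ab by (auto simp: power2_eq_square)
    define p q where "p = sqrt (1 - a\<^sup>2)" and "q = sqrt (1 - b\<^sup>2)"
    have pq: "p \<ge> 1/2" "q \<ge> 1/2"
      unfolding p_def q_def by (rule real_le_rsqrt; use sq in \<open>simp add: power2_eq_square\<close>)+
    have "(p - q) * (p + q) = (b - a) * (b + a)"
      using sq by (simp add: p_def q_def algebra_simps flip: power2_eq_square)
    then have "\<bar>p - q\<bar> * (p + q) = \<bar>b - a\<bar> * (b + a)"
      using ab pq by (metis abs_mult abs_of_nonneg add_nonneg_nonneg le_numeral_extra(3) order_trans zero_le_divide_1_iff zero_le_numeral)
    moreover have "\<bar>p - q\<bar> * 1 \<le> \<bar>p - q\<bar> * (p + q)" using pq by (intro mult_left_mono) auto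
    moreover have "\<bar>b - a\<bar> * (b + a) \<le> \<bar>b - a\<bar> * 1" using ab by (intro mult_left_mono) auto
    moreover have "\<bar>b - a\<bar> \<le> norm (x - y)"
      unfolding a_def b_def using norm_triangle_ineq3[of x y] by linarith
    ultimately show "dist (f x) (f y) \<le> 1 * dist x y"
      by (simp add: dist_norm f_def a_def b_def p_def q_def)
  qed simp
  have "ball 0 1 \<inter> U = {y + s *\<^sub>R e | y s. y \<bullet> e = 0 \<and> s < f y} \<inter> U"
  proof (intro set_eqI)
    fix w
    have "w \<in> ball 0 1 \<longleftrightarrow> w \<in> {y + s *\<^sub>R e | y s. y \<bullet> e = 0 \<and> s < f y}" if w: "w \<in> U"
    proof -
      define s y where "s = w \<bullet> e" and "y = w - s *\<^sub>R e"
      have y: "y \<bullet> e = 0" "w = y + s *\<^sub>R e" by (simp_all add: y_def s_def inner_diff_left ee)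
      have s: "s > 0" "norm y < 1/2" using w by (auto simp: U_def y_def s_def)
      have "w \<bullet> w = y \<bullet> y + s * s"
        using y(1) ee unfolding y(2) by (simp add: inner_add_left inner_add_right inner_commute)
      then have nw: "(norm w)\<^sup>2 = (norm y)\<^sup>2 + s\<^sup>2"
        by (simp add: dot_square_norm power2_eq_square)
      have "norm w < 1 \<longleftrightarrow> (norm w)\<^sup>2 < 1"
        using power_mono_iff[of 1 "norm w" 2] by (auto simp: not_le[symmetric])
      also have "\<dots> \<longleftrightarrow> s\<^sup>2 < 1 - (norm y)\<^sup>2" using nw by auto
      also have "\<dots> \<longleftrightarrow> s < f y"
      proof -
        have fy: "f y = sqrt (1 - (norm y)\<^sup>2)" using s by (simp add: f_def min_def)
        show ?thesis unfolding fy using s(1) real_sqrt_less_iff[of "s\<^sup>2" "1 - (norm y)\<^sup>2"] by simp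
      qed
      finally have *: "norm w < 1 \<longleftrightarrow> s < f y" .
      have "y' = y \<and> s' = s" if "y' \<bullet> e = 0" "w = y' + s' *\<^sub>R e" for y' s'
      proof -
        have "s' = s" using that ee by (simp add: s_def inner_add_left)
        then show ?thesis using that by (simp add: y_def)
      qed
      then show ?thesis using * y by auto
    qed
    then show "w \<in> ball 0 1 \<inter> U \<longleftrightarrow> w \<in> {y + s *\<^sub>R e | y s. y \<bullet> e = 0 \<and> s < f y} \<inter> U" by blast
  qed
  then show "\<exists>U e' f L. open U \<and> e \<in> U \<and> norm e' = 1 \<and> L-lipschitz_on {y. y \<bullet> e' = 0} f \<and>
      ball 0 1 \<inter> U = {y + s *\<^sub>R e' | y s. y \<bullet> e' = 0 \<and> s < f y} \<inter> U"
    using U eU e lip by blast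
qed

section \<open>The radial fundamental solution\<close>

lemma radial_Gamma_1: "radial_Gamma n 1 = 0"
  by (simp add: radial_Gamma_def)

lemma radial_Gamma_deriv:
  assumes "r > 0"
  shows "(radial_Gamma (Suc m) has_real_derivative 1 / r ^ m) (at r)"
proof -
  consider "m = 0" | "m = 1" | "m \<ge> 2" by linarith
  then show ?thesis
  proof cases
    case 1
    then have eq: "radial_Gamma (Suc m) = (\<lambda>r. r - 1)" by (simp add: radial_Gamma_def fun_eq_iff)
    show ?thesis unfolding eq using 1 by (auto intro!: derivative_eq_intros)
  next
    case 2
    then have eq: "radial_Gamma (Suc m) = ln" by (simp add: radial_Gamma_def fun_eq_iff)
    show ?thesis unfolding eq using 2 DERIV_ln_divide[OF assms] by simp
  next
    case 3
    then have eq: "radial_Gamma (Suc m) = (\<lambda>r. 1 / (real m - 1) * (1 - r powr (1 - real m)))"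
      by (auto simp: radial_Gamma_def fun_eq_iff)
    have "((\<lambda>r. 1 / (real m - 1) * (1 - r powr (1 - real m))) has_real_derivative
        1 / (real m - 1) * (0 - (1 - real m) * r powr (1 - real m - 1))) (at r)"
      using assms by (intro DERIV_cmult DERIV_diff DERIV_const has_real_derivative_powr)
    moreover have "1 / (real m - 1) * (0 - (1 - real m) * r powr (1 - real m - 1)) = 1 / r ^ m"
    proof -
      have "r powr (1 - real m - 1) = 1 / r ^ m"
        using assms by (simp add: powr_minus_divide powr_realpow)
      moreover have "1 / (real m - 1) * (0 - (1 - real m) * c) = c" for c
        using 3 by (simp add: divide_simps) (simp add: algebra_simps)
      ultimately show ?thesis by (simp only:)
    qed
    ultimately show ?thesis unfolding eq by (simp only:)
  qed
qed

lemma radial_Gamma_mono: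
  assumes "0 < a" "a \<le> b"
  shows "radial_Gamma (Suc m) a \<le> radial_Gamma (Suc m) b"
proof (rule DERIV_nonneg_imp_nondecreasing[OF assms(2)])
  fix r assume "a \<le> r" "r \<le> b"
  then have "r > 0" using assms by simp
  then show "\<exists>y. (radial_Gamma (Suc m) has_real_derivative y) (at r) \<and> 0 \<le> y"
    using radial_Gamma_deriv[of r m] by (intro exI[of _ "1 / r ^ m"]) simp
qed

lemma radial_Gamma_lipschitz:
  assumes "1 \<le> a" "1 \<le> b"
  shows "\<bar>radial_Gamma (Suc m) a - radial_Gamma (Suc m) b\<bar> \<le> \<bar>a - b\<bar>"
proof -
  have "norm (radial_Gamma (Suc m) a - radial_Gamma (Suc m) b) \<le> 1 * norm (a - b)"
  proof (rule field_differentiable_bound[of "{1..}"])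
    fix r :: real assume "r \<in> {1..}"
    then have r: "r \<ge> 1" by simp
    show "(radial_Gamma (Suc m) has_real_derivative 1 / r ^ m) (at r within {1..})"
      by (rule has_field_derivative_at_within[OF radial_Gamma_deriv]) (use r in simp)
    show "norm (1 / r ^ m) \<le> 1"
      using one_le_power[OF r, of m] by simp
  qed (use assms in auto)
  then show ?thesis by simp
qed

section \<open>The radial candidate and its calibration\<close>

text \<open>Here \<open>m\<close> stands for \<open>n - 1\<close>, so that the bound on \<open>\<beta>\<close> reads \<open>\<beta> \<ge> n - 1/2\<close>.\<close>

locale radial_candidate =
  fixes \<beta> \<gamma> R :: real and m :: nat
  assumes \<beta>_ge: "real m + 1 / 2 \<le> \<beta>" and R_ge: "1 \<le> R"
    and balance: "(\<beta>\<^sup>2 - \<beta> * real m / R) * (radial_delta (Suc m) \<beta> R)\<^sup>2 = \<gamma>\<^sup>2"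
begin

definition "\<delta> = radial_delta (Suc m) \<beta> R"

definition "K = \<delta> * R ^ m"

text \<open>The radial profile of \<open>u\<close> on \<open>[1, R]\<close>, extended by constants so that it is Lipschitz on the whole line.\<close>

definition "profile r = 1 - \<beta> * K * radial_Gamma (Suc m) (max 1 (min r R))"

definition gradient :: "'a::euclidean_space \<Rightarrow> 'a" where
  "gradient x = (if 1 < norm x \<and> norm x < R then - (\<beta> * flux_cap K m (norm x)) *\<^sub>R sgn x else 0)"

text \<open>A vertical flow that is constant in \<open>t\<close>. For \<open>1 < r < R\<close> its value, the second argument of the maximum, is
  dictated by \<open>\<phi>\<^sup>t = |\<nabla>u|\<^sup>2 - \<gamma>\<^sup>2\<close> on the graph of \<open>u\<close>; for \<open>r > R\<close> it has to vanish, and there the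
  second argument is nonpositive.\<close>

definition "excess r = max 0 ((\<beta>\<^sup>2 - \<beta> * real m / r) * (flux_cap K m r)\<^sup>2 - \<gamma>\<^sup>2)"

lemma \<beta>_pos: "\<beta> > 0"
  using \<beta>_ge by simp

lemma R_pos: "R > 0"
  using R_ge by simp

lemma radial_Gamma_nonneg: "1 \<le> r \<Longrightarrow> 0 \<le> radial_Gamma (Suc m) r"
  using radial_Gamma_mono[of 1 r m] by (simp add: radial_Gamma_1)

lemma \<delta>_mult: "\<delta> * (1 + \<beta> * R ^ m * radial_Gamma (Suc m) R) = 1"
  and \<delta>_pos: "0 < \<delta>" and \<delta>_le: "\<delta> \<le> 1"
proof -
  have "0 \<le> \<beta> * R ^ m * radial_Gamma (Suc m) R"
    using radial_Gamma_nonneg[OF R_ge] \<beta>_pos R_pos by simp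
  moreover have "\<delta> = 1 / (1 + \<beta> * R ^ m * radial_Gamma (Suc m) R)"
    by (simp add: \<delta>_def radial_delta_def)
  ultimately show "\<delta> * (1 + \<beta> * R ^ m * radial_Gamma (Suc m) R) = 1" "0 < \<delta>" "\<delta> \<le> 1"
    by auto
qed

lemma K_pos: "K > 0"
  using \<delta>_pos R_pos by (simp add: K_def)

lemma flux_cap_nonneg: "0 \<le> r \<Longrightarrow> 0 \<le> flux_cap K m r"
  using K_pos by (simp add: flux_cap_def)

lemma flux_cap_le_K: "1 \<le> r \<Longrightarrow> flux_cap K m r \<le> K"
  using K_pos one_le_power[of r m] by (simp add: flux_cap_def divide_le_eq mult_le_cancel_left1)

lemma flux_cap_R: "flux_cap K m R = \<delta>"
  using R_pos by (simp add: flux_cap_def K_def)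

lemma profile_inner: "r \<le> 1 \<Longrightarrow> profile r = 1"
  using R_ge by (simp add: profile_def radial_Gamma_1 max_def min_def)

lemma profile_middle: "1 \<le> r \<Longrightarrow> r \<le> R \<Longrightarrow> profile r = 1 - \<beta> * K * radial_Gamma (Suc m) r"
  by (simp add: profile_def)

lemma profile_R: "profile R = \<delta>"
  using \<delta>_mult profile_middle[OF R_ge order_refl] by (simp add: K_def algebra_simps)

lemma profile_le: "profile r \<le> 1" and profile_ge: "\<delta> \<le> profile r"
proof -
  have "0 \<le> radial_Gamma (Suc m) (max 1 (min r R))"
    by (rule radial_Gamma_nonneg) simp
  then show "profile r \<le> 1" using \<beta>_pos K_pos by (simp add: profile_def)
  have "radial_Gamma (Suc m) (max 1 (min r R)) \<le> radial_Gamma (Suc m) R"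
    using R_ge by (intro radial_Gamma_mono) auto
  then have "\<beta> * K * radial_Gamma (Suc m) (max 1 (min r R)) \<le> \<beta> * K * radial_Gamma (Suc m) R"
    using \<beta>_pos K_pos by (intro mult_left_mono) auto
  then show "\<delta> \<le> profile r" unfolding profile_R[symmetric] profile_middle[OF R_ge order_refl] by (simp add: profile_def)
qed

lemma profile_lipschitz: "\<bar>profile r - profile s\<bar> \<le> \<beta> * K * \<bar>r - s\<bar>"
proof -
  let ?c = "\<lambda>r. max 1 (min r R)"
  have "\<bar>profile r - profile s\<bar> = \<beta> * K * \<bar>radial_Gamma (Suc m) (?c s) - radial_Gamma (Suc m) (?c r)\<bar>"
    using \<beta>_pos K_pos by (simp add: profile_def abs_mult flip: right_diff_distrib)
  also have "\<dots> \<le> \<beta> * K * \<bar>?c s - ?c r\<bar>"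
    using \<beta>_pos K_pos by (intro mult_left_mono radial_Gamma_lipschitz) auto
  also have "\<dots> \<le> \<beta> * K * \<bar>r - s\<bar>"
    using \<beta>_pos K_pos by (intro mult_left_mono) auto
  finally show ?thesis .
qed

lemma profile_continuous: "continuous_on UNIV profile"
proof (rule lipschitz_on_continuous_on)
  show "(\<beta> * K)-lipschitz_on UNIV profile"
    using profile_lipschitz \<beta>_pos K_pos by (intro lipschitz_onI) (auto simp: dist_real_def)
qed

lemma profile_measurable[measurable]: "profile \<in> borel_measurable borel"
  using profile_continuous by (rule borel_measurable_continuous_onI)

lemma profile_deriv:
  assumes "r \<noteq> 1" "r \<noteq> R"
  shows "(profile has_real_derivative (if 1 < r \<and> r < R then - (\<beta> * flux_cap K m r) else 0)) (at r)"
proof -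
  consider "r < 1" | "1 < r" "r < R" | "R < r" using assms by linarith
  then show ?thesis
  proof cases
    case 1
    have "(profile has_real_derivative 0) (at r)"
      by (rule has_field_derivative_transform_within_open[of "\<lambda>_. 1" _ _ "{..<1}"])
        (use 1 profile_inner in auto)
    then show ?thesis using 1 by simp
  next
    case 2
    have "((\<lambda>r. 1 - \<beta> * K * radial_Gamma (Suc m) r) has_real_derivative 0 - \<beta> * K * (1 / r ^ m)) (at r)"
      using 2 by (intro DERIV_diff DERIV_const DERIV_cmult radial_Gamma_deriv) simp
    then have "(profile has_real_derivative 0 - \<beta> * K * (1 / r ^ m)) (at r)"
      by (rule has_field_derivative_transform_within_open[of _ _ _ "{1<..<R}"])
        (use 2 profile_middle in auto)
    then show ?thesis using 2 by (simp add: flux_cap_def)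
  next
    case 3
    have "(profile has_real_derivative 0) (at r)"
      by (rule has_field_derivative_transform_within_open[of "\<lambda>_. \<delta>" _ _ "{R<..}"])
        (use 3 profile_R in \<open>auto simp: profile_def\<close>)
    then show ?thesis using 3 by simp
  qed
qed

text \<open>Both sides equal \<open>\<delta>\<close> at \<open>R\<close>, and their difference is nonincreasing: its derivative is
  \<open>(m/r - \<beta>)\<close> times the cap.\<close>

lemma flux_cap_le_profile:
  assumes "1 \<le> r" "r \<le> R"
  shows "flux_cap K m r \<le> profile r"
proof -
  let ?f = "\<lambda>r. 1 - \<beta> * K * radial_Gamma (Suc m) r - flux_cap K m r"
  have "?f R \<le> ?f r"
  proof (rule DERIV_nonpos_imp_nonincreasing[OF assms(2)])
    fix s assume s: "r \<le> s" "s \<le> R"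
    then have s0: "1 \<le> s" "s > 0" using assms by auto
    have "(?f has_real_derivative 0 - \<beta> * K * (1 / s ^ m) - - real m * flux_cap K m s / s) (at s)"
      using s0 by (intro DERIV_diff DERIV_const DERIV_cmult radial_Gamma_deriv flux_cap_deriv) auto
    moreover have "0 - \<beta> * K * (1 / s ^ m) - - real m * flux_cap K m s / s \<le> 0"
    proof -
      have "real m / s \<le> real m" using s0 by (simp add: divide_le_eq mult_le_cancel_left1)
      then have "real m / s \<le> \<beta>" using \<beta>_ge by simp
      then have "real m / s * flux_cap K m s \<le> \<beta> * flux_cap K m s"
        using flux_cap_nonneg s0 by (intro mult_right_mono) auto
      then show ?thesis by (simp add: flux_cap_def mult.commute)
    qed
    ultimately show "\<exists>y. (?f has_real_derivative y) (at s) \<and> y \<le> 0" by blast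
  qed
  then show ?thesis
    using profile_middle[OF assms] profile_middle[OF R_ge order_refl] profile_R flux_cap_R by simp
qed

text \<open>Up to a constant the quantity is \<open>(\<beta> r - m) / r ^ (2 m + 1)\<close>, whose derivative has the sign of
  \<open>m (2 m + 1 - 2 \<beta> r)\<close>. This is nonpositive for all \<open>r \<ge> 1\<close> when \<open>\<beta> \<ge> m + 1/2\<close>.\<close>

lemma balance_antimono:
  assumes "1 \<le> a" "a \<le> b"
  shows "(\<beta>\<^sup>2 - \<beta> * real m / b) * (flux_cap K m b)\<^sup>2 \<le> (\<beta>\<^sup>2 - \<beta> * real m / a) * (flux_cap K m a)\<^sup>2"
proof -
  define F where "F r = (\<beta> * r - real m) / r ^ (2 * m + 1)" for r
  have eq: "(\<beta>\<^sup>2 - \<beta> * real m / r) * (flux_cap K m r)\<^sup>2 = \<beta> * K\<^sup>2 * F r" if "r > 0" for r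
    using that by (simp add: F_def flux_cap_def power_divide power2_eq_square field_simps
      flip: power_add mult_2)
  have "F b \<le> F a"
  proof (rule DERIV_nonpos_imp_nonincreasing[OF assms(2)])
    fix r assume "a \<le> r" "r \<le> b"
    then have r: "1 \<le> r" "r > 0" using assms by auto
    have "(F has_real_derivative (\<beta> * r ^ (2 * m + 1) - (\<beta> * r - real m) * (real (2 * m + 1) * r ^ (2 * m)))
        / (r ^ (2 * m + 1) * r ^ (2 * m + 1))) (at r)"
      unfolding F_def
    proof (rule DERIV_divide)
      show "((\<lambda>r. \<beta> * r - real m) has_real_derivative \<beta>) (at r)" by (auto intro!: derivative_eq_intros)
      show "((\<lambda>r. r ^ (2 * m + 1)) has_real_derivative real (2 * m + 1) * r ^ (2 * m)) (at r)"
        using DERIV_pow[of "2 * m + 1" r] by simp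
    qed (use r in auto)
    moreover have "\<beta> * r ^ (2 * m + 1) - (\<beta> * r - real m) * (real (2 * m + 1) * r ^ (2 * m)) =
        r ^ (2 * m) * (real m * (2 * real m + 1 - 2 * (\<beta> * r)))"
      by (simp add: algebra_simps)
    moreover have "\<beta> * 1 \<le> \<beta> * r" using \<beta>_pos r by (intro mult_left_mono) auto
    then have "2 * real m + 1 - 2 * (\<beta> * r) \<le> 0" using \<beta>_ge by linarith
    then have "r ^ (2 * m) * (real m * (2 * real m + 1 - 2 * (\<beta> * r))) \<le> 0"
      using r by (intro mult_nonneg_nonpos) auto
    ultimately show "\<exists>y. (F has_real_derivative y) (at r) \<and> y \<le> 0"
      by (metis divide_nonpos_nonneg zero_le_square)
  qed
  then show ?thesis
    using assms \<beta>_pos by (simp add: eq mult_left_mono)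
qed

lemma balance_cap: "(\<beta>\<^sup>2 - \<beta> * real m / R) * (flux_cap K m R)\<^sup>2 = \<gamma>\<^sup>2"
  unfolding flux_cap_R using balance by (simp add: \<delta>_def)

lemma excess_inside:
  assumes "1 \<le> r" "r \<le> R"
  shows "excess r = (\<beta>\<^sup>2 - \<beta> * real m / r) * (flux_cap K m r)\<^sup>2 - \<gamma>\<^sup>2"
  using balance_antimono[OF assms] balance_cap by (simp add: excess_def)

lemma excess_outside:
  assumes "R \<le> r"
  shows "excess r = 0"
  using balance_antimono[OF R_ge assms] balance_cap by (simp add: excess_def)

lemma radial_u_eq:
  fixes x :: "'a::euclidean_space"
  assumes "DIM('a) = Suc m"
  shows "radial_u \<beta> R x = (if norm x \<le> R then profile (norm x) else 0)"
  using assms R_ge profile_inner[of "norm x"] profile_middle[of "norm x"]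
  by (auto simp: radial_u_def K_def \<delta>_def mult.assoc)

lemma radial_u_measurable:
  assumes "DIM('a::euclidean_space) = Suc m"
  shows "(radial_u \<beta> R :: 'a \<Rightarrow> real) \<in> borel_measurable borel"
proof -
  have "(radial_u \<beta> R :: 'a \<Rightarrow> real) = (\<lambda>x. if norm x \<le> R then profile (norm x) else 0)"
    using radial_u_eq[OF assms] by (simp add: fun_eq_iff)
  also have "\<dots> \<in> borel_measurable borel" by measurable
  finally show ?thesis .
qed

lemma radial_u_bounds:
  fixes x :: "'a::euclidean_space"
  assumes "DIM('a) = Suc m"
  shows "0 \<le> radial_u \<beta> R x" "radial_u \<beta> R x \<le> 1" "\<bar>radial_u \<beta> R x\<bar> \<le> 1"
  using profile_ge[of "norm x"] profile_le[of "norm x"] \<delta>_pos unfolding radial_u_eq[OF assms] by auto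

text \<open>Off the tangent plane the ray \<open>x + r z\<close> moves strictly into or out of the ball of radius \<open>R\<close>, according to
  the sign of the radial derivative of the norm, so it sees only one of the two traces.\<close>

lemma radial_u_blowup:
  fixes x z :: "'a::euclidean_space"
  assumes dim: "DIM('a) = Suc m" and x: "norm x = R" and z: "sgn x \<bullet> z \<noteq> 0"
  shows "((\<lambda>r. radial_u \<beta> R (x + r *\<^sub>R z)) \<longlongrightarrow> (if z \<bullet> - sgn x > 0 then \<delta> else 0)) (at_right 0)"
proof -
  have x0: "x \<noteq> 0" using x R_pos by auto
  note d = norm_directional_derivative[OF x0, of z]
  show ?thesis
  proof (cases "sgn x \<bullet> z < 0")
    case True
    obtain e where e: "e > 0" "\<And>h. 0 < h \<Longrightarrow> h < e \<Longrightarrow> norm (x + h *\<^sub>R z) < R"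
      using DERIV_neg_dec_right[OF d True] x by auto
    have "((\<lambda>r. profile (norm (x + r *\<^sub>R z))) \<longlongrightarrow> profile (norm (x + 0 *\<^sub>R z))) (at_right 0)"
      by (rule continuous_on_tendsto_compose[OF profile_continuous]) (auto intro!: tendsto_eq_intros)
    then have "((\<lambda>r. profile (norm (x + r *\<^sub>R z))) \<longlongrightarrow> \<delta>) (at_right 0)" using x profile_R by simp
    moreover have "\<forall>\<^sub>F r in at_right 0. profile (norm (x + r *\<^sub>R z)) = radial_u \<beta> R (x + r *\<^sub>R z)"
      unfolding eventually_at_right_field using e radial_u_eq[OF dim] by (intro exI[of _ e]) (auto simp: less_imp_le)
    ultimately show ?thesis using True by (simp add: inner_commute Lim_transform_eventually)
  next
    case False
    then have "sgn x \<bullet> z > 0" using z by simp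
    then obtain e where e: "e > 0" "\<And>h. 0 < h \<Longrightarrow> h < e \<Longrightarrow> R < norm (x + h *\<^sub>R z)"
      using DERIV_pos_inc_right[OF d] x by auto
    have "\<forall>\<^sub>F r in at_right 0. radial_u \<beta> R (x + r *\<^sub>R z) = 0"
      unfolding eventually_at_right_field
    proof (intro exI[of _ e] conjI allI impI)
      fix r :: real assume "0 < r" "r < e"
      then have "\<not> norm (x + r *\<^sub>R z) \<le> R" using e(2)[of r] by simp
      then show "radial_u \<beta> R (x + r *\<^sub>R z) = 0" by (simp only: radial_u_eq[OF dim] if_False)
    qed (use e in simp)
    then show ?thesis using False by (simp add: inner_commute tendsto_eventually)
  qed
qed

lemma radial_u_continuous:
  fixes x :: "'a::euclidean_space"
  assumes dim: "DIM('a) = Suc m" and x: "norm x \<noteq> R"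
  shows "isCont (radial_u \<beta> R) x"
proof (cases "norm x < R")
  case True
  have "continuous_on (ball 0 R) (\<lambda>x::'a. profile (norm x))"
    by (rule continuous_on_compose2[OF profile_continuous]) (auto intro!: continuous_intros)
  then have "continuous_on (ball 0 R) (radial_u \<beta> R :: 'a \<Rightarrow> real)"
    by (rule continuous_on_eq) (auto simp: radial_u_eq[OF dim])
  then show ?thesis using True by (simp add: continuous_on_eq_continuous_at)
next
  case False
  have "continuous_on (- cball 0 R) (\<lambda>x::'a. 0::real)" by simp
  then have "continuous_on (- cball 0 R) (radial_u \<beta> R :: 'a \<Rightarrow> real)"
    by (rule continuous_on_eq) (auto simp: radial_u_eq[OF dim])
  then show ?thesis using False x by (simp add: continuous_on_eq_continuous_at open_Compl)
qed

theorem jump_triple_radial_u: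
  fixes x :: "'a::euclidean_space"
  assumes dim: "DIM('a) = Suc m"
  shows "jump_triple (radial_u \<beta> R) x a b \<nu> \<longleftrightarrow> norm x = R \<and> a = 0 \<and> b = \<delta> \<and> \<nu> = - sgn x"
proof (cases "norm x = R")
  case True
  then have x: "x \<noteq> 0" using R_pos by auto
  have "negligible {z. sgn x \<bullet> z = 0}" using x by (intro negligible_hyperplane) (simp add: sgn_zero_iff)
  moreover have "{z. sgn x \<bullet> z = 0} \<in> sets borel"
    by (intro borel_closed closed_hyperplane)
  ultimately have "{z. sgn x \<bullet> z = 0} \<in> null_sets lborel"
    by (auto simp: null_sets_completion_iff negligible_iff_null_sets)
  then have "AE z in lborel. z \<notin> {z. sgn x \<bullet> z = 0}" by (rule AE_not_in)
  then have lim: "AE z in lborel. ((\<lambda>r. radial_u \<beta> R (x + r *\<^sub>R z)) \<longlongrightarrow> (if z \<bullet> - sgn x > 0 then \<delta> else 0)) (at_right 0)"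
    by eventually_elim (rule radial_u_blowup[OF dim True], simp)
  have "norm (- sgn x) = 1" using x by (simp add: norm_sgn)
  from jump_triple_step[OF radial_u_measurable[OF dim] radial_u_bounds(3)[OF dim] this \<delta>_pos lim]
  show ?thesis using True by blast
next
  case False
  then show ?thesis
    using not_jump_continuous[OF radial_u_measurable[OF dim] radial_u_bounds(3)[OF dim]
        radial_u_continuous[OF dim False]] by simp
qed

lemma gradient_bound: "norm (gradient x) \<le> \<beta> * K"
proof -
  have "norm (sgn x) \<le> 1" by (simp add: norm_sgn)
  then have "\<beta> * flux_cap K m (norm x) * norm (sgn x) \<le> \<beta> * K * 1" if "1 < norm x"
    using flux_cap_le_K[of "norm x"] flux_cap_nonneg[of "norm x"] \<beta>_pos K_pos that
    by (intro mult_mono) auto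
  then show ?thesis using \<beta>_pos K_pos flux_cap_nonneg[of "norm x"] by (auto simp: gradient_def abs_mult)
qed

lemma gradient_measurable[measurable]: "gradient \<in> borel_measurable borel"
  unfolding gradient_def[abs_def] flux_cap_def by measurable

text \<open>The Gauss formula on the ball of radius \<open>R\<close> for the product of \<open>profile\<close> and \<open>\<psi>\<close>, which agrees with \<open>u \<psi>\<close> inside and with
  \<open>\<delta> \<psi>\<close> on the sphere.\<close>

lemma radial_u_weak_derivative:
  fixes \<psi> :: "'a::euclidean_space \<Rightarrow> real"
  assumes dim: "DIM('a) = Suc m" and test: "test_function UNIV \<psi>"
  shows "(LINT x|lborel. radial_u \<beta> R x * frechet_derivative \<psi> (at x) v) =
    \<delta> * (LINT x|sphere_measure R. \<psi> x * (sgn x \<bullet> v)) - (LINT x|lborel. \<psi> x * (gradient x \<bullet> v))"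
proof -
  note td = test_functionD[OF test]
  obtain L M where L: "0 \<le> L" "\<And>x y. \<bar>\<psi> x - \<psi> y\<bar> \<le> L * norm (x - y)"
    and M: "0 \<le> M" "\<And>x. \<bar>\<psi> x\<bar> \<le> M" using test_function_lipschitz[OF test] by blast
  define C where "C = closure {x. \<psi> x \<noteq> 0}"
  have C: "compact C" using test by (simp add: test_function_def C_def)
  obtain B where B: "\<And>z. z \<in> C \<Longrightarrow> norm z \<le> B"
    using compact_imp_bounded[OF C] unfolding bounded_iff by blast
  have supp: "\<psi> z = 0" "frechet_derivative \<psi> (at z) v = 0" if "z \<notin> cball 0 B" for z
  proof -
    have z: "z \<notin> closure {x. \<psi> x \<noteq> 0}" using B[of z] that by (auto simp: C_def)
    show "\<psi> z = 0" "frechet_derivative \<psi> (at z) v = 0" using td(8)[OF z] td(9)[OF z] by blast+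
  qed
  have \<psi>m[measurable]: "\<psi> \<in> borel_measurable borel"
    using td(4) by (rule borel_measurable_continuous_onI)
  have dm[measurable]: "(\<lambda>z. frechet_derivative \<psi> (at z) v) \<in> borel_measurable borel"
    using td(5) by (rule borel_measurable_continuous_onI)
  have um[measurable]: "(radial_u \<beta> R :: 'a \<Rightarrow> real) \<in> borel_measurable borel"
    by (rule radial_u_measurable[OF dim])
  define H where "H z = profile (norm z) * \<psi> z" for z
  define D where "D z = profile (norm z) * frechet_derivative \<psi> (at z) v + \<psi> z * (gradient z \<bullet> v)" for z
  have w1: "\<bar>profile r\<bar> \<le> 1" for r using profile_ge[of r] profile_le[of r] \<delta>_pos by auto
  have lipH: "(L + M * (\<beta> * K))-lipschitz_on UNIV H"
  proof (rule lipschitz_onI)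
    fix x y :: 'a
    have "H x - H y = profile (norm x) * (\<psi> x - \<psi> y) + \<psi> y * (profile (norm x) - profile (norm y))"
      by (simp add: H_def algebra_simps)
    also have "\<bar>\<dots>\<bar> \<le> \<bar>profile (norm x)\<bar> * \<bar>\<psi> x - \<psi> y\<bar> + \<bar>\<psi> y\<bar> * \<bar>profile (norm x) - profile (norm y)\<bar>"
      by (rule order_trans[OF abs_triangle_ineq]) (simp add: abs_mult)
    also have "\<dots> \<le> 1 * (L * norm (x - y)) + M * (\<beta> * K * norm (x - y))"
    proof (intro add_mono mult_mono)
      have "\<beta> * K * \<bar>norm x - norm y\<bar> \<le> \<beta> * K * norm (x - y)"
        using \<beta>_pos K_pos norm_triangle_ineq3 by (intro mult_left_mono) auto
      then show "\<bar>profile (norm x) - profile (norm y)\<bar> \<le> \<beta> * K * norm (x - y)"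
        using profile_lipschitz[of "norm x" "norm y"] by linarith
    qed (use L M w1 in auto)
    finally show "dist (H x) (H y) \<le> (L + M * (\<beta> * K)) * dist x y"
      by (simp add: dist_norm algebra_simps)
  qed (use L M \<beta>_pos K_pos in simp)
  have Dm: "D \<in> borel_measurable borel" unfolding D_def by measurable
  have deriv: "AE z in lborel. ((\<lambda>s. H (z + s *\<^sub>R v)) has_real_derivative D z) (at 0)"
    using AE_notin_sphere[of 0] AE_notin_sphere[of 1] AE_notin_sphere[of R]
  proof eventually_elim
    case (elim z)
    then have "z \<noteq> 0" by auto
    note dw = radial_directional_derivative[OF profile_deriv[OF elim(2,3)] this, of v]
    have "(if 1 < norm z \<and> norm z < R then - (\<beta> * flux_cap K m (norm z)) else 0) * (sgn z \<bullet> v) =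
        gradient z \<bullet> v"
      by (simp add: gradient_def)
    from dw[unfolded this]
    have "((\<lambda>s. profile (norm (z + s *\<^sub>R v))) has_real_derivative gradient z \<bullet> v) (at 0)" .
    from DERIV_mult[OF this td(6)[of z v]]
    show ?case by (simp add: H_def D_def algebra_simps)
  qed
  have "(LINT z|lborel. indicator (cball 0 R) z * D z) = (LINT x|sphere_measure R. H x * (sgn x \<bullet> v))"
    by (rule divergence_theorem_cball[OF lipH R_pos _ Dm deriv, of B]) (use supp in \<open>simp add: H_def\<close>)
  also have "\<dots> = (LINT x|sphere_measure R. \<delta> * (\<psi> x * (sgn x \<bullet> v)))"
  proof (rule integral_cong_AE)
    show "AE x in sphere_measure R. H x * (sgn x \<bullet> v) = \<delta> * (\<psi> x * (sgn x \<bullet> v))"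
      using AE_sphere_measure[OF R_pos] by eventually_elim (simp add: H_def profile_R)
    have "(\<lambda>x. H x * (sgn x \<bullet> v)) \<in> borel_measurable borel"
      "(\<lambda>x. \<delta> * (\<psi> x * (sgn x \<bullet> v))) \<in> borel_measurable borel" unfolding H_def by measurable
    then show "(\<lambda>x. H x * (sgn x \<bullet> v)) \<in> borel_measurable (sphere_measure R)"
      "(\<lambda>x. \<delta> * (\<psi> x * (sgn x \<bullet> v))) \<in> borel_measurable (sphere_measure R)"
      by (simp_all cong: measurable_cong_sets)
  qed
  also have "(LINT z|lborel. indicator (cball 0 R) z * D z) =
      (LINT z|lborel. radial_u \<beta> R z * frechet_derivative \<psi> (at z) v + \<psi> z * (gradient z \<bullet> v))"
    by (intro Bochner_Integration.integral_cong)
      (auto simp: D_def radial_u_eq[OF dim] gradient_def indicator_def)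
  also have "\<dots> = (LINT z|lborel. radial_u \<beta> R z * frechet_derivative \<psi> (at z) v) +
      (LINT z|lborel. \<psi> z * (gradient z \<bullet> v))"
  proof (rule Bochner_Integration.integral_add)
    have "bounded ((\<lambda>z. frechet_derivative \<psi> (at z) v) ` cball 0 B)"
      by (intro compact_imp_bounded compact_continuous_image continuous_on_subset[OF td(5)]) auto
    then obtain N where N: "\<And>z. z \<in> cball 0 B \<Longrightarrow> \<bar>frechet_derivative \<psi> (at z) v\<bar> \<le> N"
      unfolding bounded_iff by (metis image_eqI real_norm_def)
    have N': "\<bar>frechet_derivative \<psi> (at z) v\<bar> \<le> max N 0" for z
      using N[of z] supp(2)[of z] by (cases "z \<in> cball 0 B") (auto intro: max.coboundedI1)
    show "integrable lborel (\<lambda>z. radial_u \<beta> R z * frechet_derivative \<psi> (at z) v)"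
    proof (rule integrable_lborel_bounded_support[of _ B "1 * max N 0"])
      show "norm (radial_u \<beta> R z * frechet_derivative \<psi> (at z) v) \<le> 1 * max N 0" for z
        unfolding real_norm_def abs_mult using radial_u_bounds(3)[OF dim, of z] N'[of z] by (intro mult_mono) auto
    qed (use supp in simp_all)
    show "integrable lborel (\<lambda>z. \<psi> z * (gradient z \<bullet> v))"
    proof (rule integrable_lborel_bounded_support[of _ B "M * (\<beta> * K * norm v)"])
      show "norm (\<psi> z * (gradient z \<bullet> v)) \<le> M * (\<beta> * K * norm v)" for z
      proof -
        have "\<bar>gradient z \<bullet> v\<bar> \<le> norm (gradient z) * norm v" by (rule Cauchy_Schwarz_ineq2)
        also have "\<dots> \<le> \<beta> * K * norm v" by (intro mult_right_mono gradient_bound) simp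
        finally show ?thesis unfolding real_norm_def abs_mult using M by (intro mult_mono) auto
      qed
    qed (use supp in simp_all)
  qed
  finally show ?thesis by simp
qed

text \<open>The singular part of the derivative is \<open>\<delta>\<close> times the surface measure with the inner normal as its
  direction, the side of the higher trace.\<close>

theorem sbv_gradient_radial_u:
  assumes dim: "DIM('a::euclidean_space) = Suc m"
  shows "sbv_gradient (radial_u \<beta> R :: 'a \<Rightarrow> real) gradient"
proof -
  define \<mu> :: "'a measure" where "\<mu> = density (sphere_measure R) (\<lambda>_. ennreal \<delta>)"
  have sets: "sets \<mu> = sets borel" by (simp add: \<mu>_def)
  have on_sphere: "AE x in \<mu>. norm x = R"
    unfolding \<mu>_def using AE_sphere_measure[OF R_pos] by (subst AE_density) auto
  have "finite_measure \<mu>"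
  proof
    interpret finite_measure "sphere_measure R :: 'a measure" by (rule finite_sphere_measure)
    have "emeasure \<mu> (space \<mu>) = ennreal \<delta> * emeasure (sphere_measure R) (space (sphere_measure R :: 'a measure))"
      unfolding \<mu>_def space_density
      by (subst emeasure_density) (auto simp del: sets_sphere_measure intro!: nn_integral_cmult_indicator)
    then show "emeasure \<mu> (space \<mu>) \<noteq> \<infinity>"
      using emeasure_finite by (simp add: ennreal_mult_eq_top_iff)
  qed
  moreover have "AE x in \<mu>. norm (- sgn x) = 1"
    using on_sphere by eventually_elim (use R_pos in \<open>auto simp: norm_sgn\<close>)
  moreover have "AE x in \<mu>. x \<in> sphere 0 R"
    using on_sphere by eventually_elim simp
  moreover have "AE x in \<mu>. x \<in> jump_set (radial_u \<beta> R)"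
    using on_sphere by eventually_elim (auto simp: jump_set_def jump_triple_radial_u[OF dim])
  moreover have "(LINT x|lborel. radial_u \<beta> R x * frechet_derivative \<psi> (at x) v) =
      - ((LINT x|lborel. \<psi> x * (gradient x \<bullet> v)) + (LINT x|\<mu>. \<psi> x * (- sgn x \<bullet> v)))"
    if test: "test_function UNIV \<psi>" for \<psi> :: "'a \<Rightarrow> real" and v
  proof -
    have [measurable]: "\<psi> \<in> borel_measurable borel"
      using test_functionD(4)[OF test] by (rule borel_measurable_continuous_onI)
    have "(\<lambda>x. \<psi> x * (- sgn x \<bullet> v)) \<in> borel_measurable borel" by measurable
    then have "(\<lambda>x. \<psi> x * (- sgn x \<bullet> v)) \<in> borel_measurable (sphere_measure R)"
      by (simp cong: measurable_cong_sets)
    then have "(LINT x|\<mu>. \<psi> x * (- sgn x \<bullet> v)) =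
        (LINT x|sphere_measure R. \<delta> *\<^sub>R (\<psi> x * (- sgn x \<bullet> v)))"
      unfolding \<mu>_def using \<delta>_pos by (subst integral_density) auto
    also have "\<dots> = - (\<delta> * (LINT x|sphere_measure R. \<psi> x * (sgn x \<bullet> v)))"
      by simp
    finally show ?thesis using radial_u_weak_derivative[OF dim test, of v] by simp
  qed
  moreover have "integrable lborel (radial_u \<beta> R :: 'a \<Rightarrow> real)"
    by (rule integrable_lborel_bounded_support[OF radial_u_measurable[OF dim], of R 1])
      (use radial_u_bounds[OF dim] in \<open>auto simp: radial_u_eq[OF dim]\<close>)
  moreover have "integrable lborel (gradient :: 'a \<Rightarrow> 'a)"
    by (rule integrable_lborel_bounded_support[OF gradient_measurable _ gradient_bound, of R])
      (auto simp: gradient_def)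
  moreover have "(\<lambda>x::'a. - sgn x) \<in> borel_measurable borel" by measurable
  moreover have "sphere (0::'a) R \<in> null_sets lborel" by (rule null_sets_sphere)
  ultimately show ?thesis unfolding sbv_gradient_def using sets by blast
qed

lemma radial_u_admissible:
  assumes dim: "DIM('a::euclidean_space) = Suc m"
  shows "admissible (ball 0 1) (radial_u \<beta> R :: 'a \<Rightarrow> real)"
proof -
  have "{x::'a. radial_u \<beta> R x \<noteq> 0} \<subseteq> cball 0 R"
    by (auto simp: radial_u_eq[OF dim])
  then have "bounded {x::'a. radial_u \<beta> R x \<noteq> 0}" by (rule bounded_subset[OF bounded_cball])
  then show ?thesis
    using sbv_gradient_radial_u[OF dim] radial_u_bounds[OF dim]
    by (auto simp: admissible_def SBV_def compact_closure radial_u_def)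
qed

text \<open>With \<open>c = min(t, cap)\<close> the claim for \<open>t > 0\<close> is \<open>(\<beta>\<^sup>2 - \<beta> m/r) c\<^sup>2 - \<gamma>\<^sup>2 \<le> excess r\<close>; the coefficient
  is nonnegative, so the left side is largest at the cap, where it is at most \<open>excess r\<close> by definition.\<close>

lemma radial_field_lower_bound:
  fixes x :: "'a::euclidean_space"
  assumes x: "1 \<le> norm x" and t: "0 \<le> t"
  shows "snd (radial_field \<beta> K m excess (x, t)) \<ge>
    1/4 * (norm (fst (radial_field \<beta> K m excess (x, t))))\<^sup>2 - \<gamma>\<^sup>2 * indicator {0<..} t"
proof -
  define r where "r = norm x"
  define k where "k = flux_cap K m r"
  define c where "c = min t k"
  have r: "1 \<le> r" "r > 0" using x by (auto simp: r_def)
  have k: "0 \<le> k" using flux_cap_nonneg r by (simp add: k_def)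
  have c: "0 \<le> c" "c \<le> k" using t k by (auto simp: c_def)
  have "norm (sgn x) = 1" using x by (auto simp: norm_sgn)
  then have f: "norm (fst (radial_field \<beta> K m excess (x, t))) = 2 * \<beta> * c"
    using \<beta>_pos c by (simp add: radial_field_def abs_mult c_def k_def r_def)
  have s: "snd (radial_field \<beta> K m excess (x, t)) = \<beta> * real m * c\<^sup>2 / r + excess r"
    by (simp add: radial_field_def c_def k_def r_def)
  have "real m / r \<le> real m" using r by (simp add: divide_le_eq mult_le_cancel_left1)
  then have "\<beta> * (real m / r) \<le> \<beta> * \<beta>" using \<beta>_ge \<beta>_pos by (intro mult_left_mono) auto
  then have A: "0 \<le> \<beta>\<^sup>2 - \<beta> * real m / r" by (simp add: power2_eq_square)
  have main: "\<beta>\<^sup>2 * c\<^sup>2 - \<gamma>\<^sup>2 * indicator {0<..} t \<le> \<beta> * real m * c\<^sup>2 / r + excess r"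
  proof (cases "t = 0")
    case True
    then have "c = 0" using k by (simp add: c_def)
    then show ?thesis using True by (simp add: excess_def)
  next
    case False
    have "(\<beta>\<^sup>2 - \<beta> * real m / r) * c\<^sup>2 \<le> (\<beta>\<^sup>2 - \<beta> * real m / r) * k\<^sup>2"
      using A c by (intro mult_left_mono power_mono) auto
    then have "(\<beta>\<^sup>2 - \<beta> * real m / r) * c\<^sup>2 - \<gamma>\<^sup>2 \<le> excess r"
      by (auto simp: excess_def k_def)
    then show ?thesis using False t by (simp add: left_diff_distrib)
  qed
  then show ?thesis unfolding f s by (simp add: power_mult_distrib)
qed

lemma radial_field_bounded:
  "bounded (radial_field \<beta> K m excess ` ((- ball (0::'a::euclidean_space) 1) \<times> {0..1}))"
proof (rule bounded_subset[OF bounded_Times[OF bounded_cball bounded_cball]], rule image_subsetI)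
  fix z :: "'a \<times> real" assume z: "z \<in> (- ball 0 1) \<times> {0..1}"
  define r where "r = norm (fst z)"
  define c where "c = min (snd z) (flux_cap K m r)"
  have r: "1 \<le> r" "r > 0" using z by (auto simp: r_def)
  have c: "0 \<le> c" "c \<le> 1" using z flux_cap_nonneg[of r] r by (auto simp: c_def)
  have c2: "0 \<le> c\<^sup>2" "c\<^sup>2 \<le> 1" using c by (auto simp: power_le_one)
  have "norm (sgn (fst z)) \<le> 1" by (simp add: norm_sgn)
  then have "2 * \<beta> * c * norm (sgn (fst z)) \<le> 2 * \<beta> * 1 * 1" using c \<beta>_pos by (intro mult_mono) auto
  then have "fst (radial_field \<beta> K m excess z) \<in> cball 0 (2 * \<beta>)"
    using c \<beta>_pos by (simp add: radial_field_def abs_mult c_def r_def)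
  moreover have "snd (radial_field \<beta> K m excess z) \<in> cball 0 (\<beta> * real m + \<beta>\<^sup>2 * K\<^sup>2)"
  proof -
    have "\<beta> * real m * c\<^sup>2 / r \<le> \<beta> * real m * 1 / 1"
      using r c2 \<beta>_pos by (intro frac_le mult_left_mono) auto
    moreover have "0 \<le> \<beta> * real m * c\<^sup>2 / r" using r \<beta>_pos by simp
    moreover have "0 \<le> excess r" by (simp add: excess_def)
    moreover have "excess r \<le> \<beta>\<^sup>2 * K\<^sup>2"
    proof -
      have "(\<beta>\<^sup>2 - \<beta> * real m / r) * (flux_cap K m r)\<^sup>2 \<le> \<beta>\<^sup>2 * K\<^sup>2"
        using r \<beta>_pos flux_cap_le_K[OF r(1)] flux_cap_nonneg[of r] by (intro mult_mono power_mono) auto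
      then have "(\<beta>\<^sup>2 - \<beta> * real m / r) * (flux_cap K m r)\<^sup>2 - \<gamma>\<^sup>2 \<le> \<beta>\<^sup>2 * K\<^sup>2"
        using zero_le_power2[of \<gamma>] by linarith
      then show ?thesis by (simp add: excess_def)
    qed
    ultimately show ?thesis by (simp add: radial_field_def c_def r_def)
  qed
  ultimately show "radial_field \<beta> K m excess z \<in> cball 0 (2 * \<beta>) \<times> cball 0 (\<beta> * real m + \<beta>\<^sup>2 * K\<^sup>2)"
    by (simp add: mem_Times_iff)
qed

text \<open>For \<open>|x| < R\<close> the graph of \<open>u\<close> is above the cap, where the field has the slope of \<open>u\<close>; for \<open>|x| > R\<close> the
  graph is at height \<open>0\<close>, where the whole field vanishes.\<close>

lemma radial_field_on_graph:
  fixes x :: "'a::euclidean_space"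
  assumes dim: "DIM('a) = Suc m" and x: "1 < norm x" "norm x \<noteq> R"
  shows "fst (radial_field \<beta> K m excess (x, radial_u \<beta> R x)) = 2 *\<^sub>R gradient x"
    "snd (radial_field \<beta> K m excess (x, radial_u \<beta> R x)) =
      (norm (gradient x))\<^sup>2 - \<gamma>\<^sup>2 * indicator {0<..} (radial_u \<beta> R x)"
proof -
  let ?k = "flux_cap K m (norm x)"
  have k: "0 \<le> ?k" by (rule flux_cap_nonneg) simp
  have nsgn: "norm (sgn x) = 1" using x by (auto simp: norm_sgn)
  have "fst (radial_field \<beta> K m excess (x, radial_u \<beta> R x)) = 2 *\<^sub>R gradient x \<and>
    snd (radial_field \<beta> K m excess (x, radial_u \<beta> R x)) =
      (norm (gradient x))\<^sup>2 - \<gamma>\<^sup>2 * indicator {0<..} (radial_u \<beta> R x)"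
  proof (cases "norm x < R")
    case True
    have u: "radial_u \<beta> R x = profile (norm x)" using True by (simp add: radial_u_eq[OF dim])
    have min: "min (profile (norm x)) ?k = ?k" using flux_cap_le_profile[of "norm x"] x True by simp
    have "profile (norm x) > 0" using profile_ge[of "norm x"] \<delta>_pos by simp
    moreover have "norm (gradient x) = \<beta> * ?k"
      using x True \<beta>_pos k nsgn by (simp add: gradient_def abs_mult)
    ultimately show ?thesis
      using x True unfolding radial_field_def fst_conv snd_conv u min
      by (simp add: gradient_def excess_inside power_mult_distrib left_diff_distrib)
  next
    case False
    then have "R < norm x" using x by simp
    then show ?thesis using k
      by (simp add: radial_field_def radial_u_eq[OF dim] gradient_def excess_outside)
  qed
  then show "fst (radial_field \<beta> K m excess (x, radial_u \<beta> R x)) = 2 *\<^sub>R gradient x"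
    "snd (radial_field \<beta> K m excess (x, radial_u \<beta> R x)) =
      (norm (gradient x))\<^sup>2 - \<gamma>\<^sup>2 * indicator {0<..} (radial_u \<beta> R x)" by blast+
qed

theorem calibration_radial_field:
  assumes dim: "DIM('a::euclidean_space) = Suc m"
  shows "calibration \<beta> \<gamma> (ball 0 1) (radial_u \<beta> R :: 'a \<Rightarrow> real) (radial_field \<beta> K m excess)"
proof -
  let ?\<phi> = "radial_field \<beta> K m excess :: 'a \<times> real \<Rightarrow> 'a \<times> real"
  let ?D = "(- ball (0::'a) 1) \<times> {0..1::real}"
  have ce: "continuous_on {0<..} excess"
    unfolding excess_def flux_cap_def by (intro continuous_intros; simp)+
  have cont: "continuous_on ?D ?\<phi>"
    by (rule radial_field_continuous_on) (auto intro!: continuous_on_subset[OF ce])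
  have a: "AE x in lborel. x \<notin> closure (ball (0::'a) 1) \<longrightarrow>
      (\<forall>t\<in>{0..1}. snd (?\<phi> (x, t)) \<ge> 1/4 * (norm (fst (?\<phi> (x, t))))\<^sup>2 - \<gamma>\<^sup>2 * indicator {0<..} t)"
  proof (intro AE_I2 impI ballI)
    fix x :: 'a and t :: real assume "x \<notin> closure (ball 0 1)" "t \<in> {0..1}"
    then have "1 \<le> norm x" "0 \<le> t" by auto
    then show "snd (?\<phi> (x, t)) \<ge> 1/4 * (norm (fst (?\<phi> (x, t))))\<^sup>2 - \<gamma>\<^sup>2 * indicator {0<..} t"
      by (rule radial_field_lower_bound)
  qed
  have b: "hausdorff_ae (DIM('a) - 1) (- ball (0::'a) 1)
      (\<lambda>x. \<forall>r\<in>{0..1}. \<forall>s\<in>{0..1}. norm (LBINT t=ereal r..ereal s. fst (?\<phi> (x, t))) \<le> \<beta> * (r\<^sup>2 + s\<^sup>2))"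
  proof (intro hausdorff_aeI ballI)
    fix x :: 'a and r s :: real assume rs: "r \<in> {0..1}" "s \<in> {0..1}"
    let ?I = "flux_integral K m (norm x)"
    have k: "0 \<le> flux_cap K m (norm x)" by (rule flux_cap_nonneg) simp
    have I: "\<bar>?I s - ?I r\<bar> \<le> r\<^sup>2 + s\<^sup>2"
      using flux_integral_bounds[of r, OF _ k] flux_integral_bounds[of s, OF _ k] rs
        zero_le_power2[of r] zero_le_power2[of s] by (auto simp del: zero_le_power2)
    have "(LBINT t=ereal r..ereal s. fst (?\<phi> (x, t))) = - (\<beta> * (?I s - ?I r)) *\<^sub>R sgn x"
      unfolding interval_integral_radial_field flux_potential_def
      by (simp add: algebra_simps)
    then have "norm (LBINT t=ereal r..ereal s. fst (?\<phi> (x, t))) = \<beta> * \<bar>?I s - ?I r\<bar> * norm (sgn x)"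
      using \<beta>_pos by (simp add: abs_mult)
    also have "\<dots> \<le> \<beta> * (r\<^sup>2 + s\<^sup>2) * 1"
      using \<beta>_pos I by (intro mult_mono) (auto simp: norm_sgn)
    finally show "norm (LBINT t=ereal r..ereal s. fst (?\<phi> (x, t))) \<le> \<beta> * (r\<^sup>2 + s\<^sup>2)" by simp
  qed
  have a': "AE x in lborel. x \<notin> closure (ball (0::'a) 1) \<longrightarrow>
      fst (?\<phi> (x, radial_u \<beta> R x)) = 2 *\<^sub>R gradient x \<and>
      snd (?\<phi> (x, radial_u \<beta> R x)) = (norm (gradient x))\<^sup>2 - \<gamma>\<^sup>2 * indicator {0<..} (radial_u \<beta> R x)"
    using AE_notin_sphere[of R] by eventually_elim (use radial_field_on_graph[OF dim] in auto)
  have b': "hausdorff_ae (DIM('a) - 1) (jump_set (radial_u \<beta> R :: 'a \<Rightarrow> real))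
      (\<lambda>x. \<forall>a b \<nu>. jump_triple (radial_u \<beta> R) x a b \<nu> \<longrightarrow>
        (LBINT t=ereal a..ereal b. fst (?\<phi> (x, t))) = (\<beta> * (a\<^sup>2 + b\<^sup>2)) *\<^sub>R \<nu>)"
  proof (intro hausdorff_aeI allI impI)
    fix x \<nu> :: 'a and a b
    assume "jump_triple (radial_u \<beta> R) x a b \<nu>"
    then have *: "norm x = R" "a = 0" "b = \<delta>" "\<nu> = - sgn x"
      by (simp_all add: jump_triple_radial_u[OF dim])
    show "(LBINT t=ereal a..ereal b. fst (?\<phi> (x, t))) = (\<beta> * (a\<^sup>2 + b\<^sup>2)) *\<^sub>R \<nu>"
      unfolding interval_integral_radial_field flux_potential_def flux_integral_def
      using \<delta>_pos by (simp add: * flux_cap_R)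
  qed
  have div: "weakly_divergence_free ((- closure (ball (0::'a) 1)) \<times> {0<..<1}) ?\<phi>"
    by (rule radial_field_weakly_divergence_free[OF dim ce]) auto
  show ?thesis
    unfolding calibration_def
    using lipschitz_boundary_unit_ball radial_u_admissible[OF dim]
      borel_measurable_continuous_on_restrict[OF cont] radial_field_bounded
      continuous_on_approximately_regular[OF cont] div a b sbv_gradient_radial_u[OF dim] a' b'
    by (intro conjI exI[of _ gradient]) (auto simp del: closure_ball)
qed

end

theorem theorem3p8:
  fixes \<beta> \<gamma> R :: real
  assumes "\<beta> > 0" and "\<gamma> > 0"
    and "\<beta> \<ge> real CARD('n) - 1/2"
    and "R \<ge> 1"
    and "(\<beta>\<^sup>2 - \<beta> * (real CARD('n) - 1) / R) * (radial_delta CARD('n) \<beta> R)\<^sup>2 = \<gamma>\<^sup>2"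
  shows "\<exists>\<phi>. calibration \<beta> \<gamma> (ball 0 1) (radial_u \<beta> R :: real ^ 'n \<Rightarrow> real) \<phi>"
proof -
  obtain m where m: "CARD('n) = Suc m" using not0_implies_Suc[of "CARD('n)"] by auto
  interpret radial_candidate \<beta> \<gamma> R m
    by unfold_locales (use assms m in auto)
  have "DIM(real ^ 'n) = Suc m" using m by simp
  then show ?thesis using calibration_radial_field by blast
qed

end
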